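(* Let $Z \subset \mathbb{P}^2$ be a zero-dimensional subscheme with minimal free resolution $$0 \to \bigoplus_{j=1}^k \mathcal{O}(-b_j) \to \bigoplus_{i=1}^{k+1}\mathcal{O}(-a_i) \to \mathcal{I}_Z \to 0,$$ where $b_k \geq \dots \geq b_1$ and $a_{k+1}\geq \dots \geq a_1$. The following are equivalent: (1) the numerical character $\chi(Z)$ is not connected; (2) $b_p < a_{p+2}$ for some $p$ with $1 \leq p \leq k-1$.
   Context: The base field is algebraically closed of characteristic zero. $\mathcal{I}_Z$ is the ideal sheaf of $Z$ in $\mathbb{P}^2$; the minimal free resolution is the sheafification of the minimal graded free resolution of the saturated homogeneous ideal $I(Z)=\bigoplus_n H^0(\mathcal{I}_Z(n))$. Let $s=s(Z)$ be the minimal degree of a curve in $\mathbb{P}^2$ containing $Z$. The numerical character $\chi(Z)$ is the unique sequence of integers $(n_0,\dots,n_{s-1})$ with $n_0\geq n_1\geq\dots\geq n_{s-1}\geq s$ and $h^1(\mathcal{I}_Z(n))=\sum_{i=0}^{s-1}([n_i-n-1]_+-[i-n-1]_+)$ for all $n$, where $[x]_+=\max(x,0)$. Equivalently, if $H(Z,\cdot)$ is the Hilbert function of $Z$ and $\Delta(i)=H(Z,i)-H(Z,i-1)$, then $\Delta(i)=i+1$ for $0\le i<s$ and $\Delta(i)=\#\{l \mid n_l\geq i+1\}$ for $i\geq s$. The character $(n_0,\dots,n_{s-1})$ is connected if $n_i\leq n_{i+1}+1$ for all $0\leq i\leq s-2$. *)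

theory Defs
  imports
    "HOL-Library.Poly_Mapping"
    "HOL-Library.Numeral_Type"
    "HOL-Computational_Algebra.Polynomial"
begin

text \<open>
  The homogeneous coordinate ring \<open>S = K[x\<^sub>0, x\<^sub>1, x\<^sub>2]\<close> of the projective plane: finitely supported
  functions from exponent vectors to \<open>K\<close>, with the convolution product of \<open>Poly_Mapping\<close>.
\<close>

type_synonym 'a form_ring = "(3 \<Rightarrow>\<^sub>0 nat) \<Rightarrow>\<^sub>0 'a"

definition var :: "3 \<Rightarrow> 'a::comm_ring_1 form_ring" where
  "var i = Poly_Mapping.single (Poly_Mapping.single i 1) 1"

definition const :: "'a::comm_ring_1 \<Rightarrow> 'a form_ring" where
  "const c = Poly_Mapping.single 0 c"

definition mon_degree :: "(3 \<Rightarrow>\<^sub>0 nat) \<Rightarrow> nat" where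
  "mon_degree m = (\<Sum>i\<in>UNIV. Poly_Mapping.lookup m i)"

text \<open>
  Degrees are integers; the zero polynomial is homogeneous of every degree, and it is the only
  one that is homogeneous of a negative degree.
\<close>

definition homogeneous :: "int \<Rightarrow> 'a::comm_ring_1 form_ring \<Rightarrow> bool" where
  "homogeneous d f \<longleftrightarrow> (\<forall>m\<in>Poly_Mapping.keys f. int (mon_degree m) = d)"

text \<open>
  A commutative ring as a module over itself: \<open>idl.subspace\<close> is the predicate ``is an ideal'' and
  \<open>idl.span B\<close> is the ideal generated by \<open>B\<close>.
\<close>

interpretation idl: module "(*) :: 'r::comm_ring_1 \<Rightarrow> 'r \<Rightarrow> 'r"
  by unfold_locales (simp_all add: algebra_simps)

text \<open>The ring \<open>S\<close> as a vector space over \<open>K\<close>.\<close>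

interpretation kvec: vector_space "\<lambda>(c :: 'a::field) (f :: 'a form_ring). const c * f"
proof
  fix c d :: 'a and f g :: "'a form_ring"
  show "const c * (f + g) = const c * f + const c * g"
    by (rule distrib_left)
  show "const (c + d) * f = const c * f + const d * f"
    by (simp add: const_def single_add distrib_right)
  show "const c * (const d * f) = const (c * d) * f"
    by (simp add: const_def mult_single flip: mult.assoc)
  show "const 1 * f = f"
    by (simp add: const_def)
qed

definition irrelevant_ideal :: "'a::comm_ring_1 form_ring set" where
  "irrelevant_ideal = idl.span (range var)"

definition homogeneous_ideal :: "'a::comm_ring_1 form_ring set \<Rightarrow> bool" where
  "homogeneous_ideal I \<longleftrightarrow> idl.span {f \<in> I. \<exists>d. homogeneous d f} = I"

definition saturated :: "'a::comm_ring_1 form_ring set \<Rightarrow> bool" where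
  "saturated I \<longleftrightarrow>
     (\<forall>f. (\<exists>N::nat. \<forall>g. homogeneous (int N) g \<longrightarrow> g * f \<in> I) \<longrightarrow> f \<in> I)"

definition prime_ideal :: "'r::comm_ring_1 set \<Rightarrow> bool" where
  "prime_ideal P \<longleftrightarrow>
     idl.subspace P \<and> P \<noteq> UNIV \<and> (\<forall>f g. f * g \<in> P \<longrightarrow> f \<in> P \<or> g \<in> P)"

text \<open>
  The underlying set of \<open>Proj (S / I)\<close>, with its points viewed as homogeneous primes of \<open>S\<close>.
\<close>

definition proj_points :: "'a::comm_ring_1 form_ring set \<Rightarrow> 'a form_ring set set" where
  "proj_points I =
     {P. prime_ideal P \<and> homogeneous_ideal P \<and> I \<subseteq> P \<and> \<not> irrelevant_ideal \<subseteq> P}"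

text \<open>
  A closed subscheme \<open>Z\<close> of the projective plane is represented by its saturated homogeneous
  ideal \<open>I(Z)\<close>; this is a bijection between closed subschemes and such ideals. The dimension of
  \<open>Z\<close> is the supremum of the lengths of the chains of specializations of its points. It is zero
  iff \<open>Z\<close> is nonempty and has no proper specializations.
\<close>

definition zero_dim_subscheme :: "'a::comm_ring_1 form_ring set \<Rightarrow> bool" where
  "zero_dim_subscheme I \<longleftrightarrow>
     homogeneous_ideal I \<and> saturated I \<and>
     proj_points I \<noteq> {} \<and> \<not> (\<exists>P\<in>proj_points I. \<exists>Q\<in>proj_points I. P \<subset> Q)"

text \<open>
  Graded free modules: \<open>free_module n\<close> is the free module \<open>S\<^sup>n\<close> with coordinates indexed by
  \<open>1, \<dots>, n\<close>. A matrix \<open>M\<close> is a degree-preserving map from the sum of the \<open>S(- b j)\<close> to the sum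
  of the \<open>S(- a i)\<close> iff each \<open>M i j\<close> is homogeneous of degree \<open>b j - a i\<close>.
\<close>

definition free_module :: "nat \<Rightarrow> (nat \<Rightarrow> 'r::comm_ring_1) set" where
  "free_module n = {v. \<forall>i. i \<notin> {1..n} \<longrightarrow> v i = 0}"

definition matrix_map ::
    "nat \<Rightarrow> nat \<Rightarrow> (nat \<Rightarrow> nat \<Rightarrow> 'r::comm_ring_1) \<Rightarrow> (nat \<Rightarrow> 'r) \<Rightarrow> (nat \<Rightarrow> 'r)" where
  "matrix_map m n M v = (\<lambda>i. if i \<in> {1..m} then \<Sum>j=1..n. M i j * v j else 0)"

definition row_map :: "nat \<Rightarrow> (nat \<Rightarrow> 'r::comm_ring_1) \<Rightarrow> (nat \<Rightarrow> 'r) \<Rightarrow> 'r" where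
  "row_map m g v = (\<Sum>i=1..m. g i * v i)"

text \<open>
  \<open>0 \<rightarrow> \<Oplus>\<^sub>j S(- b j) \<rightarrow> \<Oplus>\<^sub>i S(- a i) \<rightarrow> I \<rightarrow> 0\<close> with \<open>1 \<le> j \<le> k\<close> and \<open>1 \<le> i \<le> k + 1\<close> is an exact
  sequence of graded modules, and it is minimal: the image of the first map lies in the
  irrelevant ideal times the middle module.
\<close>

definition minimal_free_resolution ::
    "'a::comm_ring_1 form_ring set \<Rightarrow> nat \<Rightarrow> (nat \<Rightarrow> int) \<Rightarrow> (nat \<Rightarrow> int) \<Rightarrow>
     (nat \<Rightarrow> nat \<Rightarrow> 'a form_ring) \<Rightarrow> (nat \<Rightarrow> 'a form_ring) \<Rightarrow> bool" where
  "minimal_free_resolution I k b a M g \<longleftrightarrow>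
     (\<forall>i\<in>{1..k+1}. homogeneous (a i) (g i)) \<and>
     (\<forall>i\<in>{1..k+1}. \<forall>j\<in>{1..k}. homogeneous (b j - a i) (M i j)) \<and>
     inj_on (matrix_map (k+1) k M) (free_module k) \<and>
     matrix_map (k+1) k M ` free_module k = {v \<in> free_module (k+1). row_map (k+1) g v = 0} \<and>
     row_map (k+1) g ` free_module (k+1) = I \<and>
     matrix_map (k+1) k M ` free_module k \<subseteq> {v. \<forall>i\<in>{1..k+1}. v i \<in> irrelevant_ideal}"

text \<open>
  The Hilbert function \<open>H(Z, n) = dim (S / I)\<^sub>n\<close>, zero for negative \<open>n\<close>. The graded pieces of \<open>S\<close>
  are finite-dimensional, so the dimension of the quotient is a difference of dimensions.
\<close>

definition hilbert_function :: "'a::field form_ring set \<Rightarrow> int \<Rightarrow> int" where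
  "hilbert_function I n =
     int (kvec.dim {f :: 'a form_ring. homogeneous n f}) - int (kvec.dim {f \<in> I. homogeneous n f})"

definition hilbert_diff :: "'a::field form_ring set \<Rightarrow> int \<Rightarrow> int" where
  "hilbert_diff I i = hilbert_function I i - hilbert_function I (i - 1)"

definition min_curve_degree :: "'a::comm_ring_1 form_ring set \<Rightarrow> nat" where
  "min_curve_degree I = (LEAST d. \<exists>f\<in>I. f \<noteq> 0 \<and> homogeneous (int d) f)"

text \<open>
  The numerical character, through the first difference \<open>\<Delta>\<close> of the Hilbert function. In terms of
  cohomology the two conditions on \<open>\<Delta>\<close> say that
  \<open>h\<^sup>1(I\<^sub>Z(n)) = \<Sum>i<s. [n\<^sub>i - n - 1]\<^sub>+ - [i - n - 1]\<^sub>+\<close> for all \<open>n\<close>, because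
  \<open>h\<^sup>1(I\<^sub>Z(n - 1)) - h\<^sup>1(I\<^sub>Z(n)) = \<Delta>(n)\<close> and \<open>h\<^sup>1(I\<^sub>Z(n)) = 0\<close> for large \<open>n\<close>.
\<close>

definition is_numerical_character :: "'a::field form_ring set \<Rightarrow> int list \<Rightarrow> bool" where
  "is_numerical_character I ns \<longleftrightarrow>
     (let s = min_curve_degree I in
       length ns = s \<and> sorted_wrt (\<ge>) ns \<and> (\<forall>x\<in>set ns. x \<ge> int s) \<and>
       (\<forall>i. 0 \<le> i \<and> i < int s \<longrightarrow> hilbert_diff I i = i + 1) \<and>
       (\<forall>i\<ge>int s. hilbert_diff I i = int (card {l. l < s \<and> ns ! l \<ge> i + 1})))"

definition numerical_character :: "'a::field form_ring set \<Rightarrow> int list" where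
  "numerical_character I = (THE ns. is_numerical_character I ns)"

definition connected_character :: "int list \<Rightarrow> bool" where
  "connected_character ns \<longleftrightarrow> (\<forall>i. i + 1 < length ns \<longrightarrow> ns ! i \<le> ns ! (i + 1) + 1)"

end

theory Submission
  imports Defs "HOL-Library.Function_Algebras" "Jordan_Normal_Form.Determinant"
begin

text \<open>
  Let \<open>\<Delta>\<close> be the first difference of the Hilbert function of \<open>Z\<close>. The resolution computes it: the second
  difference at \<open>n \<ge> 0\<close> is \<open>1 - #{i. a i \<le> n} + #{j. b j \<le> n}\<close>. Minimality forces \<open>a (p + 1) < b p\<close>, for
  otherwise \<open>p\<close> columns of \<open>M\<close> would be supported in the first \<open>p\<close> rows; that square block kills a
  nonzero row vector, so it is singular and \<open>M\<close> is not injective (\<open>a_less_b\<close>). These inequalities say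
  that \<open>\<Delta>\<close> does not increase from \<open>s = a 1\<close> on.

  The limit of \<open>\<Delta>\<close> is the difference of the sums of the \<open>a i\<close> and of the \<open>b j\<close>. It vanishes because the
  Hilbert function of a zero-dimensional subscheme is bounded (\<open>hilbert_function_bounded\<close>). So \<open>\<Delta>\<close>
  restricted to \<open>n \<ge> s\<close> is the conjugate of a unique decreasing sequence, which is the numerical
  character. A gap of at least two in that sequence is the same as two equal consecutive values
  \<open>\<Delta> (i - 1) = \<Delta> i\<close> strictly between \<open>0\<close> and \<open>s\<close> with \<open>i > s\<close> (\<open>connected_is_conjugate_iff\<close>). If
  \<open>p = #{j. b j \<le> i}\<close>, equality of the two values means \<open>#{i'. a i' \<le> i} = p + 1\<close>, that is
  \<open>b p \<le> i < a (p + 2)\<close>. Conversely, if \<open>b p < a (p + 2)\<close>, then \<open>i = b p\<close> works: the strict inequalities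
  \<open>a 2 < b 1\<close> and \<open>a (k + 1) < b k\<close> make \<open>\<Delta>\<close> drop strictly at \<open>a 2\<close>, which is before \<open>i\<close>, and at
  \<open>a (k + 1)\<close>, which is after \<open>i\<close> (\<open>plateau_iff\<close>).

  Boundedness is proved with two applications of Zorn's lemma, in place of primary decomposition. Let
  \<open>x\<close> be a coordinate and let \<open>J\<close> be the ideal of all \<open>t\<close> with \<open>x ^ n * t \<in> I\<close> for some \<open>n\<close>. A point of \<open>Z\<close> on
  the line \<open>x = 0\<close> does not contain \<open>J\<close>, since otherwise a homogeneous prime over \<open>I\<close> that avoids
  \<open>x\<close> would lie strictly inside it. Hence no relevant homogeneous prime contains \<open>J + (x)\<close>, and
  \<open>J + (x)\<close> contains all forms of some degree \<open>N\<close>. Modulo \<open>x\<close>, the monomials of degree \<open>N\<close> are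
  represented by finitely many \<open>t \<mu> \<in> J\<close>, so the forms of degree \<open>N + q\<close> are spanned by
  \<open>x ^ q * \<mu>\<close> and by the multiples \<open>t \<mu> * v\<close> with \<open>v\<close> of degree \<open>q\<close>. Fix \<open>m\<close> such that \<open>x ^ m * t \<mu> \<in> I\<close> for
  all \<open>\<mu>\<close>, and a form \<open>f \<in> I\<close> that is not divisible by \<open>x\<close>; it exists because otherwise \<open>Z\<close>
  would contain the line \<open>x = 0\<close>. Then \<open>t \<mu> * v \<in> I\<close> for \<open>v\<close> in the complete intersection ideal
  \<open>(f, x ^ m)\<close>, whose codimension in degree \<open>q\<close> is bounded.
\<close>

section \<open>Dimensions of finite-dimensional subspaces\<close>

text \<open>
  The representation of \<open>v\<close> in the basis \<open>C\<close> is supported on \<open>B\<close> and on its complement, hence nowhere.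
\<close>

lemma (in vector_space) span_Int_independent:
  assumes "independent C" "B \<subseteq> C" "v \<in> span B" "v \<in> span (C - B)"
  shows "v = 0"
proof -
  have 1: "representation C v = representation B v"
    by (rule representation_extend) (use assms in auto)
  have 2: "representation C v = representation (C - B) v"
    by (rule representation_extend) (use assms in auto)
  have "representation C v = (\<lambda>_. 0)"
  proof
    fix x show "representation C v x = 0"
      using representation_ne_zero[of B v x] representation_ne_zero[of "C - B" v x] 1 2 by (metis DiffD2)
  qed
  moreover have "v \<in> span C" using assms(2,3) span_mono by blast
  ultimately show ?thesis
    using sum_nonzero_representation_eq[OF assms(1), of v] by simp
qed

lemma (in vector_space) dim_mono_finite:
  assumes "V \<subseteq> W" "W \<subseteq> span F" "finite F" shows "dim V \<le> dim W"
proof -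
  obtain B where B: "B \<subseteq> W" "independent B" "W \<subseteq> span B" "card B = dim W" using basis_exists by blast
  have "finite B" using independent_span_bound[OF assms(3) B(2)] B(1) assms(2) by blast
  with B assms(1) show ?thesis using dim_le_card[of V B] by auto
qed

text \<open>
  Rank-nullity for a finite-dimensional subspace of an arbitrary vector space: the ring of forms has
  infinite dimension, while the maps below are only ever restricted to graded pieces.
\<close>

lemma (in vector_space_pair) dim_eq_kernel_plus_image:
  assumes V: "vs1.subspace V" "V \<subseteq> vs1.span F" "finite F" and f: "Vector_Spaces.linear s1 s2 f"
  shows "vs1.dim V = vs1.dim {v \<in> V. f v = 0} + vs2.dim (f ` V)"
proof -
  interpret f: module_hom s1 s2 f using f by (simp add: linear_iff_module_hom)
  let ?K = "{v \<in> V. f v = 0}"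
  obtain B where B: "B \<subseteq> ?K" "vs1.independent B" "?K \<subseteq> vs1.span B" "card B = vs1.dim ?K"
    using vs1.basis_exists by blast
  obtain C where C: "B \<subseteq> C" "C \<subseteq> V" "vs1.independent C" "V \<subseteq> vs1.span C"
    using vs1.maximal_independent_subset_extend[of B V] B by blast
  have finC: "finite C" using vs1.independent_span_bound[OF V(3) C(3)] C(2) V(2) by blast
  let ?D = "C - B"
  have spanC: "vs1.span C \<subseteq> V" using C(2) V(1) by (rule vs1.span_minimal)
  have inj: "inj_on f (vs1.span ?D)"
  proof (subst f.inj_on_iff_eq_0)
    show "vs1.subspace (vs1.span ?D)" by simp
    show "\<forall>x\<in>vs1.span ?D. f x = 0 \<longrightarrow> x = 0"
    proof (intro ballI impI)
      fix x assume x: "x \<in> vs1.span ?D" "f x = 0"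
      have "x \<in> V" using x(1) vs1.span_mono[of ?D C] spanC by blast
      with x B have "x \<in> vs1.span B" by blast
      with x show "x = 0" using vs1.span_Int_independent[OF C(3,1)] by blast
    qed
  qed
  have ind: "vs2.independent (f ` ?D)"
    using f.independent_injective_image[OF vs1.independent_mono[OF C(3)] inj] by blast
  have "f ` V \<subseteq> vs2.span (f ` ?D)"
  proof -
    have "f ` C \<subseteq> vs2.span (f ` ?D)"
    proof
      fix y assume "y \<in> f ` C"
      then obtain x where "x \<in> C" "y = f x" by blast
      show "y \<in> vs2.span (f ` ?D)"
      proof (cases "x \<in> B")
        case True
        hence "y = 0" using B(1) \<open>y = f x\<close> by auto
        thus ?thesis by (simp add: vs2.span_zero)
      next
        case False
        thus ?thesis using \<open>x \<in> C\<close> \<open>y = f x\<close> by (intro vs2.span_base) auto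
      qed
    qed
    hence "vs2.span (f ` C) \<subseteq> vs2.span (f ` ?D)" by (simp add: vs2.span_minimal)
    thus ?thesis using f.spans_image[OF C(4)] by blast
  qed
  hence "card (f ` ?D) = vs2.dim (f ` V)"
    using vs2.basis_card_eq_dim[OF _ _ ind] C(2) by blast
  moreover have "card (f ` ?D) = card ?D"
    by (rule card_image) (meson inj inj_on_subset vs1.span_superset)
  moreover have "vs1.dim V = card C" using vs1.basis_card_eq_dim[OF C(2,4,3)] by simp
  moreover have "card C = card B + card ?D"
    using C(1) finC by (metis card_Diff_subset card_mono finite_subset le_add_diff_inverse)
  ultimately show ?thesis using B(4) by simp
qed

lemma (in vector_space) dim_le_add_card:
  assumes U: "U \<subseteq> span F" "finite F" and A: "finite A" and V: "V \<subseteq> {u + x | u x. u \<in> U \<and> x \<in> span A}"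
  shows "dim V \<le> dim U + card A"
proof -
  obtain B where B: "B \<subseteq> U" "independent B" "U \<subseteq> span B" "card B = dim U" using basis_exists by blast
  have finB: "finite B" using independent_span_bound[OF U(2) B(2)] B(1) U(1) by blast
  have "V \<subseteq> span (B \<union> A)"
    using V B(3) span_mono[of B "B \<union> A"] span_mono[of A "B \<union> A"] span_add by blast
  hence "dim V \<le> card (B \<union> A)" using finB A by (intro dim_le_card) auto
  also have "\<dots> \<le> card B + card A" by (rule card_Un_le)
  finally show ?thesis using B(4) by simp
qed

lemma (in vector_space) exists_complement:
  assumes U: "subspace U" "U \<subseteq> V" and V: "V \<subseteq> span F" "finite F"
  obtains A where "A \<subseteq> V" "finite A" "card A = dim V - dim U" "V \<subseteq> {u + x | u x. u \<in> U \<and> x \<in> span A}"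
proof -
  obtain B where B: "B \<subseteq> U" "independent B" "U \<subseteq> span B" "card B = dim U" using basis_exists by blast
  obtain C where C: "B \<subseteq> C" "C \<subseteq> V" "independent C" "V \<subseteq> span C"
    using maximal_independent_subset_extend[of B V] B U by blast
  have finC: "finite C" using independent_span_bound[OF V(2) C(3)] C(2) V(1) by blast
  have "card (C - B) = dim V - dim U"
    using B(4) basis_card_eq_dim[OF C(2,4,3)] C(1) finC by (metis card_Diff_subset finite_subset)
  moreover have "V \<subseteq> {u + x | u x. u \<in> U \<and> x \<in> span (C - B)}"
  proof
    fix v assume "v \<in> V"
    hence "v \<in> span (B \<union> (C - B))" using C by (metis Un_Diff_cancel subsetD sup.absorb2)
    then obtain u x where "v = u + x" "u \<in> span B" "x \<in> span (C - B)" unfolding span_Un by blast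
    moreover have "span B \<subseteq> U" using span_minimal[OF B(1) U(1)] .
    ultimately show "v \<in> {u + x | u x. u \<in> U \<and> x \<in> span (C - B)}" by blast
  qed
  ultimately show ?thesis using that[of "C - B"] C finC by blast
qed

section \<open>The graded ring of forms\<close>

text \<open>
  These two rewrite rules reassociate products to the left and make \<open>algebra_simps\<close> and \<open>mult_ac\<close> loop.
\<close>

declare idl.scale_scale [simp del] kvec.scale_scale [simp del]

text \<open>
  Both the homogeneous components of a form and the substitution of zero for some variables keep
  exactly those terms whose exponent satisfies a predicate.
\<close>

definition restrict_keys :: "('k \<Rightarrow> bool) \<Rightarrow> ('k \<Rightarrow>\<^sub>0 'a::zero) \<Rightarrow> ('k \<Rightarrow>\<^sub>0 'a)" where
  "restrict_keys Q = Poly_Mapping.mapp (\<lambda>k c. if Q k then c else 0)"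

lemma lookup_restrict_keys [simp]:
  "Poly_Mapping.lookup (restrict_keys Q f) k = (if Q k then Poly_Mapping.lookup f k else 0)"
  by (auto simp: restrict_keys_def lookup_mapp when_def in_keys_iff)

lemma keys_restrict_keys [simp]: "Poly_Mapping.keys (restrict_keys Q f) = {k \<in> Poly_Mapping.keys f. Q k}"
  by (auto simp: in_keys_iff split: if_splits)

lemma restrict_keys_add: "restrict_keys Q (f + g) = restrict_keys Q f + restrict_keys Q (g :: _ \<Rightarrow>\<^sub>0 'a::comm_monoid_add)"
  by (rule poly_mapping_eqI) (simp add: lookup_add)

lemma restrict_keys_zero [simp]: "restrict_keys Q 0 = 0"
  by (rule poly_mapping_eqI) simp

lemma restrict_keys_sum: "restrict_keys Q (\<Sum>x\<in>X. F x) = (\<Sum>x\<in>X. restrict_keys Q (F x :: _ \<Rightarrow>\<^sub>0 'a::comm_monoid_add))"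
  by (induction X rule: infinite_finite_induct) (simp_all add: restrict_keys_add)

lemma restrict_keys_id: "(\<And>k. k \<in> Poly_Mapping.keys f \<Longrightarrow> Q k) \<Longrightarrow> restrict_keys Q f = f"
  by (rule poly_mapping_eqI) (auto simp: in_keys_iff)

lemma restrict_keys_eq_0_iff: "restrict_keys Q f = 0 \<longleftrightarrow> (\<forall>k \<in> Poly_Mapping.keys f. \<not> Q k)"
  by (auto simp: poly_mapping_eq_iff fun_eq_iff in_keys_iff)

lemma restrict_keys_split:
  "f = restrict_keys Q f + restrict_keys (\<lambda>k. \<not> Q k) (f :: _ \<Rightarrow>\<^sub>0 'a::comm_monoid_add)"
  by (rule poly_mapping_eqI) (simp add: lookup_add)

text \<open>
  The terms of \<open>g\<close> outside \<open>R\<close> contribute only terms outside \<open>Q\<close>. For \<open>f\<close> homogeneous this computes the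
  components of a product.
\<close>

lemma restrict_keys_mult_left:
  fixes f g :: "'k::comm_monoid_add \<Rightarrow>\<^sub>0 'a::comm_ring_1"
  assumes "\<And>k l. k \<in> Poly_Mapping.keys f \<Longrightarrow> Q (k + l) \<longleftrightarrow> R l"
  shows "restrict_keys Q (f * g) = f * restrict_keys R g"
proof -
  have "restrict_keys Q (f * restrict_keys R g) = f * restrict_keys R g"
    by (rule restrict_keys_id) (use assms keys_mult[of f "restrict_keys R g"] in fastforce)
  moreover have "restrict_keys Q (f * restrict_keys (\<lambda>l. \<not> R l) g) = 0"
    unfolding restrict_keys_eq_0_iff using assms keys_mult[of f "restrict_keys (\<lambda>l. \<not> R l) g"] by fastforce
  ultimately show ?thesis
    by (subst restrict_keys_split[of g R]) (simp add: distrib_left restrict_keys_add)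
qed

text \<open>
  The exponents outside \<open>Q\<close> form an ideal of the monoid, so deleting them is a ring homomorphism.
\<close>

lemma restrict_keys_mult:
  fixes f g :: "'k::comm_monoid_add \<Rightarrow>\<^sub>0 'a::comm_ring_1"
  assumes Q: "\<And>k l. Q (k + l) \<longleftrightarrow> Q k \<and> Q l"
  shows "restrict_keys Q (f * g) = restrict_keys Q f * restrict_keys Q g"
proof -
  have "restrict_keys Q (restrict_keys Q f * g) = restrict_keys Q f * restrict_keys Q g"
    by (rule restrict_keys_mult_left) (use Q in auto)
  moreover have "restrict_keys Q (restrict_keys (\<lambda>l. \<not> Q l) f * g) = 0"
    unfolding restrict_keys_eq_0_iff using Q keys_mult[of "restrict_keys (\<lambda>l. \<not> Q l) f" g] by fastforce
  ultimately show ?thesis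
    by (subst restrict_keys_split[of f Q]) (simp add: distrib_right restrict_keys_add)
qed

lemma sum_single_lookup:
  fixes f :: "'k \<Rightarrow>\<^sub>0 'a::comm_monoid_add"
  assumes "finite X" "Poly_Mapping.keys f \<subseteq> X"
  shows "(\<Sum>k\<in>X. Poly_Mapping.single k (Poly_Mapping.lookup f k)) = f"
proof (rule poly_mapping_eqI)
  fix k
  show "Poly_Mapping.lookup (\<Sum>k\<in>X. Poly_Mapping.single k (Poly_Mapping.lookup f k)) k = Poly_Mapping.lookup f k"
    using assms by (auto simp: lookup_sum lookup_single when_def in_keys_iff)
qed

lemma UNIV_3: "(UNIV :: 3 set) = {0, 1, 2}"
  by (rule card_subset_eq[symmetric]) simp_all

lemma mon_degree_add: "mon_degree (m + m') = mon_degree m + mon_degree m'"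
  by (simp add: mon_degree_def lookup_add sum.distrib)

lemma mon_degree_zero [simp]: "mon_degree 0 = 0"
  by (simp add: mon_degree_def)

lemma mon_degree_single [simp]: "mon_degree (Poly_Mapping.single i n) = n"
  by (simp add: mon_degree_def lookup_single when_def)

lemma mon_degree_eq: "mon_degree m = Poly_Mapping.lookup m 0 + Poly_Mapping.lookup m 1 + Poly_Mapping.lookup m 2"
  unfolding mon_degree_def UNIV_3 by simp

lemma homogeneous_zero [simp]: "homogeneous d 0"
  by (simp add: homogeneous_def)

lemma homogeneous_add: "homogeneous d f \<Longrightarrow> homogeneous d g \<Longrightarrow> homogeneous d (f + g)"
  using keys_add[of f g] by (auto simp: homogeneous_def)

lemma homogeneous_minus: "homogeneous d (- f) \<longleftrightarrow> homogeneous d f"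
  by (simp add: homogeneous_def in_keys_iff)

lemma homogeneous_mult: "homogeneous d f \<Longrightarrow> homogeneous e g \<Longrightarrow> homogeneous (d + e) (f * g)"
  using keys_mult[of f g] by (fastforce simp: homogeneous_def mon_degree_add)

lemma homogeneous_single: "homogeneous (int (mon_degree m)) (Poly_Mapping.single m c)"
  by (simp add: homogeneous_def)

lemma homogeneous_const: "homogeneous 0 (const c)"
  by (simp add: homogeneous_def const_def)

lemma homogeneous_const_mult: "homogeneous d f \<Longrightarrow> homogeneous d (const c * f)"
  using homogeneous_mult[OF homogeneous_const, of d f c] by simp

lemma var_power: "var i ^ n = (Poly_Mapping.single (Poly_Mapping.single i n) 1 :: 'a::comm_ring_1 form_ring)"
proof (induction n)
  case (Suc n)
  have "Poly_Mapping.single i 1 + Poly_Mapping.single i n = (Poly_Mapping.single i (Suc n) :: 3 \<Rightarrow>\<^sub>0 nat)"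
    by (simp flip: single_add)
  thus ?case unfolding power_Suc Suc by (simp add: var_def mult_single)
qed simp

lemma homogeneous_var_power: "homogeneous (int n) (var i ^ n)"
  using homogeneous_single[of "Poly_Mapping.single i n"] by (simp add: var_power)

lemma homogeneous_var: "homogeneous 1 (var i)"
  using homogeneous_var_power[of 1 i] by simp

lemma var_neq_0 [simp]: "var i \<noteq> (0 :: 'a::comm_ring_1 form_ring)"
  by (metis var_def lookup_single_eq lookup_zero one_neq_zero)

definition hcomp :: "int \<Rightarrow> 'a::comm_ring_1 form_ring \<Rightarrow> 'a form_ring" where
  "hcomp d = restrict_keys (\<lambda>m. int (mon_degree m) = d)"

lemma homogeneous_hcomp [simp]: "homogeneous d (hcomp d f)"
  by (simp add: homogeneous_def hcomp_def)

lemma hcomp_add: "hcomp d (f + g) = hcomp d f + hcomp d g"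
  by (simp add: hcomp_def restrict_keys_add)

lemma hcomp_zero [simp]: "hcomp d 0 = 0"
  by (simp add: hcomp_def)

lemma hcomp_sum: "hcomp d (\<Sum>x\<in>X. F x) = (\<Sum>x\<in>X. hcomp d (F x))"
  by (simp add: hcomp_def restrict_keys_sum)

lemma hcomp_id: "homogeneous d f \<Longrightarrow> hcomp d f = f"
  unfolding hcomp_def by (rule restrict_keys_id) (simp add: homogeneous_def)

lemma hcomp_mult: "homogeneous d u \<Longrightarrow> hcomp n (u * f) = u * hcomp (n - d) f"
  unfolding hcomp_def by (rule restrict_keys_mult_left) (auto simp: homogeneous_def mon_degree_add)

lemma sum_hcomp:
  assumes "finite D" "\<And>m. m \<in> Poly_Mapping.keys f \<Longrightarrow> int (mon_degree m) \<in> D"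
  shows "(\<Sum>d\<in>D. hcomp d f) = f"
proof (rule poly_mapping_eqI)
  fix m
  show "Poly_Mapping.lookup (\<Sum>d\<in>D. hcomp d f) m = Poly_Mapping.lookup f m"
    using assms by (auto simp: lookup_sum hcomp_def in_keys_iff) 
qed

definition degrees :: "'a::comm_ring_1 form_ring \<Rightarrow> int set" where
  "degrees f = (\<lambda>m. int (mon_degree m)) ` Poly_Mapping.keys f"

lemma finite_degrees [simp]: "finite (degrees f)"
  by (simp add: degrees_def)

lemma sum_hcomp_degrees: "(\<Sum>d\<in>degrees f. hcomp d f) = f"
  by (rule sum_hcomp) (auto simp: degrees_def)

lemma hcomp_eq_0_iff: "hcomp d f = 0 \<longleftrightarrow> d \<notin> degrees f"
  unfolding hcomp_def restrict_keys_eq_0_iff by (auto simp: degrees_def)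

text \<open>
  The usual criterion: an ideal is generated by forms iff it contains the components of its elements.
\<close>

lemma homogeneous_ideal_iff:
  "homogeneous_ideal I \<longleftrightarrow> idl.subspace I \<and> (\<forall>f\<in>I. \<forall>d. hcomp d f \<in> I)"
proof
  assume I: "homogeneous_ideal I"
  let ?H = "{f \<in> I. \<exists>d. homogeneous d f}"
  have span: "idl.span ?H = I" using I by (simp add: homogeneous_ideal_def)
  have sub: "idl.subspace I" using idl.subspace_span[of ?H] by (simp only: span)
  have "hcomp d f \<in> I" if "f \<in> I" for f d
  proof -
    have "f \<in> idl.span ?H" using that by (simp only: span)
    thus ?thesis
    proof (induction rule: idl.span_induct_alt)
      case base
      show ?case using idl.subspace_0[OF sub] by simp
    next
      case (step u f g)
      obtain e where "f \<in> I" "homogeneous e f" using step by blast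
      hence "hcomp d (u * f) \<in> I" using hcomp_mult[of e f d u] idl.subspace_scale[OF sub, of f] by (metis mult.commute)
      thus ?case using step idl.subspace_add[OF sub] by (simp add: hcomp_add)
    qed
  qed
  with sub show "idl.subspace I \<and> (\<forall>f\<in>I. \<forall>d. hcomp d f \<in> I)" by blast
next
  assume I: "idl.subspace I \<and> (\<forall>f\<in>I. \<forall>d. hcomp d f \<in> I)"
  let ?H = "{f \<in> I. \<exists>d. homogeneous d f}"
  have "f \<in> idl.span ?H" if "f \<in> I" for f
  proof -
    have "(\<Sum>d\<in>degrees f. hcomp d f) \<in> idl.span ?H"
      by (rule idl.span_sum, rule idl.span_base) (use I that homogeneous_hcomp in blast)
    thus ?thesis by (simp add: sum_hcomp_degrees)
  qed
  moreover have "idl.span ?H \<subseteq> I" using I by (intro idl.span_minimal) auto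
  ultimately show "homogeneous_ideal I" unfolding homogeneous_ideal_def by blast
qed

lemma irrelevant_ideal_lookup_0:
  assumes "f \<in> irrelevant_ideal" shows "Poly_Mapping.lookup f 0 = 0"
proof -
  have [simp]: "Poly_Mapping.single i (Suc 0) + l \<noteq> 0" for i :: 3 and l
    by (metis lookup_add lookup_single_eq lookup_zero add_eq_0_iff_both_eq_0 Suc_neq_Zero)
  from assms show ?thesis unfolding irrelevant_ideal_def
  proof (induction rule: idl.span_induct_alt)
    case (step u f g)
    then obtain i where f: "f = var i" by blast
    have "restrict_keys (\<lambda>m. m = 0) (var i * u) = var i * restrict_keys (\<lambda>_. False) u"
      by (rule restrict_keys_mult_left) (simp add: var_def)
    also have "restrict_keys (\<lambda>_. False) u = 0" by (simp add: restrict_keys_eq_0_iff)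
    finally have "restrict_keys (\<lambda>m. m = 0) (var i * u) = 0" by simp
    hence "Poly_Mapping.lookup (restrict_keys (\<lambda>m. m = 0) (var i * u)) 0 = 0" by simp
    thus ?case using step f by (simp add: lookup_add mult.commute)
  qed simp
qed

lemma mon_degree_eq_0_iff: "mon_degree m = 0 \<longleftrightarrow> m = 0"
  by (auto simp: mon_degree_def poly_mapping_eq_iff fun_eq_iff)

text \<open>
  A form of degree zero is a constant, and the irrelevant ideal contains no nonzero constant. This is how
  minimality of a resolution is used.
\<close>

lemma homogeneous_nonpos_irrelevant:
  assumes "homogeneous d f" "d \<le> 0" "f \<in> irrelevant_ideal"
  shows "f = 0"
proof (rule ccontr)
  assume "f \<noteq> 0"
  then obtain m where m: "m \<in> Poly_Mapping.keys f" by fastforce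
  hence "mon_degree m = 0" using assms by (auto simp: homogeneous_def)
  hence "m = 0" by (simp add: mon_degree_eq_0_iff)
  with m irrelevant_ideal_lookup_0[OF assms(3)] show False by (simp add: in_keys_iff)
qed

lemma homogeneous_nonzero_degree: "homogeneous d f \<Longrightarrow> f \<noteq> 0 \<Longrightarrow> d \<ge> 0"
  by (auto simp: homogeneous_def simp flip: keys_eq_empty)

section \<open>Spaces of forms of fixed degree\<close>

definition forms :: "int \<Rightarrow> 'a::comm_ring_1 form_ring set" where
  "forms n = {f. homogeneous n f}"

lemma subspace_forms: "kvec.subspace (forms n)"
  by (rule kvec.subspaceI) (auto simp: forms_def intro: homogeneous_add homogeneous_const_mult)

text \<open>
  The parameters are the partial degrees \<open>s = m\<^sub>0 + m\<^sub>1\<close> and \<open>i = m\<^sub>0\<close>; with this order the count is a sum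
  over \<open>s\<close> whose increments can be read off.
\<close>

lemma monomials_of_degree_eq:
  "{m. mon_degree m = d} = (\<lambda>(s, i). Poly_Mapping.single 0 i + Poly_Mapping.single 1 (s - i) + Poly_Mapping.single 2 (d - s)) ` (SIGMA s:{..d}. {..s})"
  (is "?L = ?F ` ?R")
proof
  show "?F ` ?R \<subseteq> ?L" by (auto simp: mon_degree_add)
  show "?L \<subseteq> ?F ` ?R"
  proof
    fix m :: "3 \<Rightarrow>\<^sub>0 nat" assume m: "m \<in> ?L"
    let ?s = "Poly_Mapping.lookup m 0 + Poly_Mapping.lookup m 1"
    have "m = ?F (?s, Poly_Mapping.lookup m 0)"
    proof (rule poly_mapping_eqI)
      fix i :: 3
      have "i \<in> {0, 1, 2}" using UNIV_3 by blast
      thus "Poly_Mapping.lookup m i = Poly_Mapping.lookup (?F (?s, Poly_Mapping.lookup m 0)) i"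
        using m by (auto simp: lookup_add lookup_single when_def mon_degree_eq)
    qed
    thus "m \<in> ?F ` ?R" using m by (intro image_eqI[of _ _ "(?s, Poly_Mapping.lookup m 0)"]) (auto simp: mon_degree_eq)
  qed
qed

lemma card_monomials_degree: "card {m. mon_degree m = d} = (\<Sum>s\<le>d. s + 1)"
proof -
  have "inj_on (\<lambda>(s, i). Poly_Mapping.single 0 i + Poly_Mapping.single 1 (s - i) + Poly_Mapping.single (2::3) (d - s)) (SIGMA s:{..d}. {..s})"
  proof (rule inj_onI, clarsimp)
    fix s i s' i'
    assume le: "s \<le> d" "i \<le> s" "s' \<le> d" "i' \<le> s'"
      and eq: "Poly_Mapping.single 0 i + Poly_Mapping.single 1 (s - i) + Poly_Mapping.single (2::3) (d - s) =
        Poly_Mapping.single 0 i' + Poly_Mapping.single 1 (s' - i') + Poly_Mapping.single 2 (d - s')"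
    from arg_cong[OF eq, of "\<lambda>m. Poly_Mapping.lookup m 0"] arg_cong[OF eq, of "\<lambda>m. Poly_Mapping.lookup m 2"] le
    show "s = s' \<and> i = i'" by (simp add: lookup_add lookup_single when_def)
  qed
  thus ?thesis unfolding monomials_of_degree_eq by (subst card_image) simp_all
qed

lemma finite_monomials_of_degree: "finite {m. int (mon_degree m) = n}"
proof (cases "n \<ge> 0")
  case True
  hence "{m. int (mon_degree m) = n} = {m. mon_degree m = nat n}" by auto
  thus ?thesis unfolding monomials_of_degree_eq by simp
next
  case False
  hence "{m. int (mon_degree m) = n} = {}" by auto
  thus ?thesis by (metis finite.emptyI)
qed

definition monomials :: "int \<Rightarrow> 'a::comm_ring_1 form_ring set" where
  "monomials n = (\<lambda>m. Poly_Mapping.single m 1) ` {m. int (mon_degree m) = n}"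

lemma finite_monomials [simp]: "finite (monomials n)"
  by (simp add: monomials_def finite_monomials_of_degree)

lemma const_mult_single: "const c * Poly_Mapping.single m d = Poly_Mapping.single m (c * d)"
  by (simp add: const_def mult_single)

lemma span_monomials: "kvec.span (monomials n) = forms n"
proof (rule kvec.span_subspace[OF _ _ subspace_forms])
  show "monomials n \<subseteq> forms n"
    using homogeneous_single by (force simp: monomials_def forms_def)
  show "forms n \<subseteq> kvec.span (monomials n :: 'a form_ring set)"
  proof
    fix f :: "'a form_ring" assume f: "f \<in> forms n"
    have "(\<Sum>m\<in>Poly_Mapping.keys f. Poly_Mapping.single m (Poly_Mapping.lookup f m)) \<in> kvec.span (monomials n)"
    proof (rule kvec.span_sum)
      fix m assume "m \<in> Poly_Mapping.keys f"
      hence "Poly_Mapping.single m 1 \<in> (monomials n :: 'a form_ring set)"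
        using f by (auto simp: monomials_def forms_def homogeneous_def)
      from kvec.span_scale[OF kvec.span_base[OF this], of "Poly_Mapping.lookup f m"]
      show "Poly_Mapping.single m (Poly_Mapping.lookup f m) \<in> kvec.span (monomials n)"
        by (simp add: const_mult_single)
    qed
    thus "f \<in> kvec.span (monomials n)" by (simp add: sum_single_lookup)
  qed
qed

lemma independent_monomials: "kvec.independent (monomials n :: 'a::field form_ring set)"
proof (rule kvec.independent_if_scalars_zero)
  fix u :: "'a form_ring \<Rightarrow> 'a" and x :: "'a form_ring"
  assume eq: "(\<Sum>x\<in>monomials n. const (u x) * x) = 0" and x: "x \<in> monomials n"
  then obtain m where m: "x = Poly_Mapping.single m 1" "int (mon_degree m) = n" by (auto simp: monomials_def)
  have "0 = Poly_Mapping.lookup (\<Sum>x\<in>monomials n. const (u x) * x) m" by (simp add: eq)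
  also have "\<dots> = (\<Sum>x\<in>monomials n. if x = Poly_Mapping.single m 1 then u x else 0)"
    unfolding lookup_sum by (rule sum.cong) (auto simp: monomials_def const_mult_single lookup_single when_def)
  also have "\<dots> = u x" using x m by (simp add: sum.delta)
  finally show "u x = 0" by simp
qed simp

definition dim_forms :: "'a::field itself \<Rightarrow> int \<Rightarrow> int" where
  "dim_forms _ n = int (kvec.dim (forms n :: 'a form_ring set))"

lemma dim_forms_card: "dim_forms TYPE('a::field) n = int (card {m. int (mon_degree m) = n})"
proof -
  have "kvec.dim (forms n :: 'a form_ring set) = card (monomials n :: 'a form_ring set)"
    unfolding span_monomials[symmetric] by (rule kvec.dim_span_eq_card_independent[OF independent_monomials])
  also have "\<dots> = card {m. int (mon_degree m) = n}"
    unfolding monomials_def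
    by (rule card_image, rule inj_onI) (metis lookup_single_eq lookup_single_not_eq one_neq_zero)
  finally show ?thesis by (simp add: dim_forms_def)
qed

lemma dim_forms_diff: "dim_forms TYPE('a::field) n - dim_forms TYPE('a) (n - 1) = max (n + 1) 0"
proof -
  have neg: "dim_forms TYPE('a) n = 0" if "n < 0" for n
  proof -
    have "{m. int (mon_degree m) = n} = {}" using that by auto
    thus ?thesis by (simp add: dim_forms_card)
  qed
  have pos: "dim_forms TYPE('a) (int d) = (\<Sum>s\<le>d. int s + 1)" for d
    by (simp add: dim_forms_card card_monomials_degree add.commute)
  consider "n < 0" | "n = 0" | d where "n = int (Suc d)" 
    by (metis not_less_iff_gr_or_eq zero_less_imp_eq_int gr0_implies_Suc)
  thus ?thesis
  proof cases
    case 3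
    hence "n - 1 = int d" by simp
    thus ?thesis using pos[of d] pos[of "Suc d"] 3 by simp
  qed (use neg pos[of 0] in auto)
qed

lemma hilbert_function_nonneg: "hilbert_function (I :: 'a::field form_ring set) n \<ge> 0"
proof -
  have "kvec.dim {f \<in> I. homogeneous n f} \<le> kvec.dim (forms n :: 'a form_ring set)"
    by (rule kvec.dim_mono_finite[of _ _ "monomials n"]) (auto simp: span_monomials forms_def)
  thus ?thesis by (simp add: hilbert_function_def forms_def)
qed

lemma subspace_homogeneous_part:
  assumes "idl.subspace I" shows "kvec.subspace {f \<in> I. homogeneous n (f :: 'a::field form_ring)}"
  by (rule kvec.subspaceI)
    (use assms in \<open>auto intro: homogeneous_add homogeneous_const_mult idl.subspace_add idl.subspace_0 idl.subspace_scale\<close>)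

text \<open>
  The elements of \<open>A\<close> have degree \<open>n\<close>, hence so does the component in \<open>I\<close>, and \<open>A\<close> spans the quotient.
\<close>

lemma hilbert_function_le_card:
  fixes I :: "'a::field form_ring set"
  assumes A: "finite A" "A \<subseteq> forms n" and sp: "forms n \<subseteq> {u + x | u x. u \<in> I \<and> x \<in> kvec.span A}"
  shows "hilbert_function I n \<le> int (card A)"
proof -
  let ?U = "{f \<in> I. homogeneous n f}"
  have "kvec.dim (forms n :: 'a form_ring set) \<le> kvec.dim ?U + card A"
  proof (rule kvec.dim_le_add_card[of ?U "monomials n" A])
    show "?U \<subseteq> kvec.span (monomials n)" by (auto simp: span_monomials forms_def)
    show "forms n \<subseteq> {u + x | u x. u \<in> ?U \<and> x \<in> kvec.span A}"
    proof
      fix f :: "'a form_ring" assume f: "f \<in> forms n"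
      with sp obtain u x where ux: "f = u + x" "u \<in> I" "x \<in> kvec.span A" by blast
      have "x \<in> forms n" using ux(3) kvec.span_minimal[OF A(2) subspace_forms] by blast
      hence "f - x \<in> forms n" using f by (rule kvec.subspace_diff[OF subspace_forms, rotated])
      hence "u \<in> forms n" using ux by simp
      thus "f \<in> {u + x | u x. u \<in> ?U \<and> x \<in> kvec.span A}" using ux by (auto simp: forms_def)
    qed
  qed (use A in auto)
  thus ?thesis by (simp add: hilbert_function_def forms_def)
qed

text \<open>
  A basis of the quotient, lifted to forms.
\<close>

lemma hilbert_function_complement:
  fixes I :: "'a::field form_ring set"
  assumes I: "idl.subspace I"
  obtains A where "finite A" "A \<subseteq> forms n" "int (card A) = hilbert_function I n"
    "forms n \<subseteq> {u + x | u x. u \<in> I \<and> x \<in> kvec.span A}"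
proof -
  let ?U = "{f \<in> I. homogeneous n f}"
  have sub: "?U \<subseteq> forms n" by (auto simp: forms_def)
  have fin: "forms n \<subseteq> kvec.span (monomials n :: 'a form_ring set)" by (simp add: span_monomials)
  obtain A where A: "A \<subseteq> forms n" "finite A" "card A = kvec.dim (forms n :: 'a form_ring set) - kvec.dim ?U"
    "forms n \<subseteq> {u + x | u x. u \<in> ?U \<and> x \<in> kvec.span A}"
    by (rule kvec.exists_complement[OF subspace_homogeneous_part[OF I] sub fin finite_monomials])
  have "kvec.dim ?U \<le> kvec.dim (forms n :: 'a form_ring set)"
    by (rule kvec.dim_mono_finite[OF sub fin]) simp
  hence "int (card A) = hilbert_function I n" using A(3) by (simp add: hilbert_function_def forms_def)
  moreover have "forms n \<subseteq> {u + x | u x. u \<in> I \<and> x \<in> kvec.span A}" using A(4) by blast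
  ultimately show ?thesis using that[of A] A by blast
qed

section \<open>Hilbert functions from graded free resolutions\<close>

lemma const_mult: "const (a * b) = const a * const b"
  by (simp add: const_def mult_single)

text \<open>
  Tuples of forms, as a vector space over the base field. The dimension of the graded pieces of free modules is
  computed here.
\<close>

interpretation fvec: vector_space "\<lambda>(c :: 'a::field) (v :: nat \<Rightarrow> 'a form_ring) i. const c * v i"
  by unfold_locales
    (simp_all add: fun_eq_iff kvec.scale_right_distrib kvec.scale_left_distrib const_mult mult.assoc)

lemma fvec_vector_space_pairs:
  "vector_space_pair (\<lambda>(c :: 'a::field) (v :: nat \<Rightarrow> 'a form_ring) i. const c * v i) (\<lambda>c f. const c * f)"
  "vector_space_pair (\<lambda>(c :: 'a::field) (v :: nat \<Rightarrow> 'a form_ring) i. const c * v i) (\<lambda>c (w :: nat \<Rightarrow> 'a form_ring) i. const c * w i)"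
  by (intro vector_space_pair.intro fvec.vector_space_axioms kvec.vector_space_axioms)+

definition graded_free_part :: "nat \<Rightarrow> (nat \<Rightarrow> int) \<Rightarrow> int \<Rightarrow> (nat \<Rightarrow> 'a::comm_ring_1 form_ring) set" where
  "graded_free_part m a n = {v \<in> free_module m. \<forall>i\<in>{1..m}. homogeneous (n - a i) (v i)}"

lemma subspace_graded_free_part: "fvec.subspace (graded_free_part m a n)"
  by (rule fvec.subspaceI)
    (auto simp: graded_free_part_def free_module_def intro: homogeneous_add homogeneous_const_mult)

lemma linear_from_fvec_iff:
  "Vector_Spaces.linear (\<lambda>c (v :: nat \<Rightarrow> 'a::field form_ring) i. const c * v i) (\<lambda>c f. const c * f) h \<longleftrightarrow>
    (\<forall>v w. h (\<lambda>i. v i + w i) = h v + h w) \<and> (\<forall>c v. h (\<lambda>i. const c * v i) = const c * h v)"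
  "Vector_Spaces.linear (\<lambda>c (v :: nat \<Rightarrow> 'a::field form_ring) i. const c * v i) (\<lambda>c (w :: nat \<Rightarrow> 'a form_ring) i. const c * w i) h' \<longleftrightarrow>
    (\<forall>v w. h' (\<lambda>i. v i + w i) = (\<lambda>i. h' v i + h' w i)) \<and> (\<forall>c v. h' (\<lambda>i. const c * v i) = (\<lambda>i. const c * h' v i))"
  unfolding Vector_Spaces.linear_iff plus_fun_def
  using kvec.vector_space_axioms fvec.vector_space_axioms by blast+

lemma graded_free_part_finite_dim:
  "\<exists>F. finite F \<and> (graded_free_part m a n :: (nat \<Rightarrow> 'a::field form_ring) set) \<subseteq> fvec.span F"
proof -
  define e :: "nat \<Rightarrow> 'a form_ring \<Rightarrow> nat \<Rightarrow> 'a form_ring" where "e i f = (\<lambda>_. 0)(i := f)" for i f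
  let ?F = "\<Union>i\<in>{1..m}. e i ` monomials (n - a i)"
  have e: "e i f \<in> fvec.span ?F" if "i \<in> {1..m}" "homogeneous (n - a i) f" for i f
  proof -
    have "f \<in> kvec.span (monomials (n - a i))" using that by (simp add: span_monomials forms_def)
    thus ?thesis
    proof (induction rule: kvec.span_induct_alt)
      case base
      have "e i 0 = 0" by (auto simp: e_def)
      thus ?case by (simp only: fvec.span_zero)
    next
      case (step c x y)
      have "e i (const c * x + y) = (\<lambda>j. const c * e i x j) + e i y" by (auto simp: e_def)
      moreover have "(\<lambda>j. const c * e i x j) \<in> fvec.span ?F"
        by (rule fvec.span_scale, rule fvec.span_base) (use step that in auto)
      ultimately show ?case using step by (simp only: fvec.span_add)
    qed
  qed
  have "v \<in> fvec.span ?F" if v: "v \<in> graded_free_part m a n" for v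
  proof -
    have "(\<Sum>i\<in>{1..m}. e i (v i)) = v"
    proof
      fix j
      have "(\<Sum>i\<in>{1..m}. e i (v i)) j = (\<Sum>i\<in>{1..m}. e i (v i) j)" by (induction m) simp_all
      also have "\<dots> = (\<Sum>i\<in>{1..m}. if i = j then v i else 0)" by (rule sum.cong) (auto simp: e_def)
      finally show "(\<Sum>i\<in>{1..m}. e i (v i)) j = v j"
        using v by (auto simp: graded_free_part_def free_module_def)
    qed
    moreover have "(\<Sum>i\<in>{1..m}. e i (v i)) \<in> fvec.span ?F"
      by (rule fvec.span_sum, rule e) (use v in \<open>auto simp: graded_free_part_def\<close>)
    ultimately show ?thesis by (simp only:)
  qed
  thus ?thesis by (intro exI[of _ ?F]) auto
qed

text \<open>
  Projection to the last coordinate has the free module with one generator less as kernel.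
\<close>

lemma dim_graded_free_part:
  "int (fvec.dim (graded_free_part m a n :: (nat \<Rightarrow> 'a::field form_ring) set)) = (\<Sum>i=1..m. dim_forms TYPE('a) (n - a i))"
proof (induction m)
  case 0
  have "graded_free_part 0 a n = ({0} :: (nat \<Rightarrow> 'a form_ring) set)"
    by (auto simp: graded_free_part_def free_module_def)
  also have "fvec.dim {0 :: nat \<Rightarrow> 'a form_ring} = 0"
    using fvec.dim_le_card[of "{0}" "{}"] by simp
  finally show ?case by simp
next
  case (Suc m)
  let ?V = "graded_free_part (Suc m) a n :: (nat \<Rightarrow> 'a form_ring) set"
  obtain F where F: "finite F" "?V \<subseteq> fvec.span F" using graded_free_part_finite_dim by blast
  have "fvec.dim ?V = fvec.dim {v \<in> ?V. v (Suc m) = 0} + kvec.dim ((\<lambda>v. v (Suc m)) ` ?V)"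
    by (rule vector_space_pair.dim_eq_kernel_plus_image[OF fvec_vector_space_pairs(1) subspace_graded_free_part F(2,1)])
      (simp add: linear_from_fvec_iff)
  also have "{v \<in> ?V. v (Suc m) = 0} = graded_free_part m a n"
    by (auto simp: graded_free_part_def free_module_def le_Suc_eq)
  also have "(\<lambda>v. v (Suc m)) ` ?V = forms (n - a (Suc m))"
  proof
    show "forms (n - a (Suc m)) \<subseteq> (\<lambda>v. v (Suc m)) ` ?V"
    proof
      fix f :: "'a form_ring" assume "f \<in> forms (n - a (Suc m))"
      hence "(\<lambda>i. if i = Suc m then f else 0) \<in> ?V"
        by (auto simp: forms_def graded_free_part_def free_module_def)
      thus "f \<in> (\<lambda>v. v (Suc m)) ` ?V" by (rule image_eqI[rotated]) simp
    qed
  qed (auto simp: forms_def graded_free_part_def)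
  finally show ?case using Suc by (simp add: dim_forms_def)
qed

text \<open>
  A minimal free resolution without the minimality condition. The general notion also covers the
  Koszul complex of \<open>(f, x ^ m)\<close>, which is not minimal if \<open>f\<close> or \<open>x ^ m\<close> is a constant.
\<close>

definition graded_free_resolution ::
    "'a::comm_ring_1 form_ring set \<Rightarrow> nat \<Rightarrow> (nat \<Rightarrow> int) \<Rightarrow> (nat \<Rightarrow> int) \<Rightarrow>
     (nat \<Rightarrow> nat \<Rightarrow> 'a form_ring) \<Rightarrow> (nat \<Rightarrow> 'a form_ring) \<Rightarrow> bool" where
  "graded_free_resolution I k b a M g \<longleftrightarrow>
     (\<forall>i\<in>{1..k+1}. homogeneous (a i) (g i)) \<and>
     (\<forall>i\<in>{1..k+1}. \<forall>j\<in>{1..k}. homogeneous (b j - a i) (M i j)) \<and>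
     inj_on (matrix_map (k+1) k M) (free_module k) \<and>
     matrix_map (k+1) k M ` free_module k = {v \<in> free_module (k+1). row_map (k+1) g v = 0} \<and>
     row_map (k+1) g ` free_module (k+1) = I"

text \<open>
  The generator with index \<open>i\<close> has degree \<open>a i\<close>, so a tuple of degree \<open>n\<close> has a form of degree \<open>n - a i\<close> there.
\<close>

definition module_hcomp :: "nat \<Rightarrow> (nat \<Rightarrow> int) \<Rightarrow> int \<Rightarrow> (nat \<Rightarrow> 'a::comm_ring_1 form_ring) \<Rightarrow> (nat \<Rightarrow> 'a form_ring)" where
  "module_hcomp m a n v = (\<lambda>i. if i \<in> {1..m} then hcomp (n - a i) (v i) else 0)"

lemma module_hcomp_in: "module_hcomp m a n v \<in> graded_free_part m a n"
  by (auto simp: module_hcomp_def graded_free_part_def free_module_def)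

lemma module_hcomp_id: "v \<in> graded_free_part m a n \<Longrightarrow> module_hcomp m a n v = v"
  by (auto simp: module_hcomp_def graded_free_part_def free_module_def hcomp_id)

lemma graded_free_part_subset: "graded_free_part m a n \<subseteq> free_module m"
  by (auto simp: graded_free_part_def)

lemma row_map_module_hcomp:
  assumes "\<And>i. i \<in> {1..m} \<Longrightarrow> homogeneous (a i) (g i)"
  shows "row_map m g (module_hcomp m a n v) = hcomp n (row_map m g v)"
  unfolding row_map_def hcomp_sum
proof (rule sum.cong)
  fix i assume i: "i \<in> {1..m}"
  thus "g i * module_hcomp m a n v i = hcomp n (g i * v i)"
    unfolding hcomp_mult[OF assms[OF i]] by (simp add: module_hcomp_def)
qed simp

lemma matrix_map_module_hcomp:
  assumes "\<And>i j. i \<in> {1..m} \<Longrightarrow> j \<in> {1..k} \<Longrightarrow> homogeneous (b j - a i) (M i j)"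
  shows "matrix_map m k M (module_hcomp k b n w) = module_hcomp m a n (matrix_map m k M w)"
proof
  fix i
  show "matrix_map m k M (module_hcomp k b n w) i = module_hcomp m a n (matrix_map m k M w) i"
  proof (cases "i \<in> {1..m}")
    case True
    have "(\<Sum>j=1..k. M i j * module_hcomp k b n w j) = (\<Sum>j=1..k. hcomp (n - a i) (M i j * w j))"
    proof (rule sum.cong)
      fix j assume j: "j \<in> {1..k}"
      have "hcomp (n - a i) (M i j * w j) = M i j * hcomp (n - a i - (b j - a i)) (w j)"
        using assms[OF True j] by (rule hcomp_mult)
      thus "M i j * module_hcomp k b n w j = hcomp (n - a i) (M i j * w j)"
        using j by (simp add: module_hcomp_def)
    qed simp
    thus ?thesis using True by (simp only: matrix_map_def module_hcomp_def[of m] hcomp_sum if_True)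
  next
    case False
    thus ?thesis by (simp only: matrix_map_def module_hcomp_def if_False)
  qed
qed

lemma matrix_map_add: "matrix_map m n M (\<lambda>i. v i + w i) = (\<lambda>i. matrix_map m n M v i + matrix_map m n M w i)"
  by (rule ext) (simp add: matrix_map_def distrib_left sum.distrib)

lemma matrix_map_scale: "matrix_map m n M (\<lambda>i. c * v i) = (\<lambda>i. c * matrix_map m n M v i)"
  by (rule ext) (simp add: matrix_map_def sum_distrib_left mult.left_commute)

lemma matrix_map_zero [simp]: "matrix_map m n M (\<lambda>_. 0) = (\<lambda>_. 0)"
  by (auto simp: matrix_map_def)

lemma zero_in_free_module [simp]: "(\<lambda>_. 0) \<in> free_module m"
  by (simp add: free_module_def)

text \<open>
  Rank-nullity in degree \<open>n\<close>. Exactness of the whole sequence restricts to the graded pieces because the two maps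
  commute with taking components.
\<close>

lemma graded_free_resolution_dim:
  fixes I :: "'a::field form_ring set"
  assumes res: "graded_free_resolution I k b a M g"
  shows "int (kvec.dim {f \<in> I. homogeneous n f}) =
    (\<Sum>i=1..k+1. dim_forms TYPE('a) (n - a i)) - (\<Sum>j=1..k. dim_forms TYPE('a) (n - b j))"
proof -
  have g: "homogeneous (a i) (g i)" if "i \<in> {1..k+1}" for i
    using res that unfolding graded_free_resolution_def by blast
  have M: "homogeneous (b j - a i) (M i j)" if "i \<in> {1..k+1}" "j \<in> {1..k}" for i j
    using res that unfolding graded_free_resolution_def by blast
  have inj: "inj_on (matrix_map (k+1) k M) (free_module k)"
    and ker: "matrix_map (k+1) k M ` free_module k = {v \<in> free_module (k+1). row_map (k+1) g v = 0}"
    and im: "row_map (k+1) g ` free_module (k+1) = I"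
    using res unfolding graded_free_resolution_def by blast+
  let ?V = "graded_free_part (k+1) a n :: (nat \<Rightarrow> 'a form_ring) set"
  let ?W = "graded_free_part k b n :: (nat \<Rightarrow> 'a form_ring) set"
  let ?M = "matrix_map (k+1) k M" and ?g = "row_map (k+1) g"
  obtain F where F: "finite F" "?V \<subseteq> fvec.span F" using graded_free_part_finite_dim by blast
  obtain G where G: "finite G" "?W \<subseteq> fvec.span G" using graded_free_part_finite_dim by blast
  have "fvec.dim ?V = fvec.dim {v \<in> ?V. ?g v = 0} + kvec.dim (?g ` ?V)"
    by (rule vector_space_pair.dim_eq_kernel_plus_image[OF fvec_vector_space_pairs(1) subspace_graded_free_part F(2,1)])
      (unfold linear_from_fvec_iff row_map_def, simp only: distrib_left sum.distrib sum_distrib_left mult.left_commute, simp)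
  moreover have "?g ` ?V = {f \<in> I. homogeneous n f}"
  proof
    show "?g ` ?V \<subseteq> {f \<in> I. homogeneous n f}"
    proof safe
      fix v assume v: "v \<in> ?V"
      show "?g v \<in> I" unfolding im[symmetric] by (rule imageI, rule subsetD[OF graded_free_part_subset v])
      have "?g (module_hcomp (k+1) a n v) = hcomp n (?g v)"
        by (rule row_map_module_hcomp[OF g])
      hence "hcomp n (?g v) = ?g v" by (simp only: module_hcomp_id[OF v])
      with homogeneous_hcomp[of n "?g v"] show "homogeneous n (?g v)" by (simp only:)
    qed
    show "{f \<in> I. homogeneous n f} \<subseteq> ?g ` ?V"
    proof
      fix f assume f: "f \<in> {f \<in> I. homogeneous n f}"
      hence "f \<in> ?g ` free_module (k+1)" unfolding im by blast
      then obtain v where v: "f = ?g v" by blast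
      have "?g (module_hcomp (k+1) a n v) = hcomp n f"
        unfolding v by (rule row_map_module_hcomp[OF g])
      also have "\<dots> = f" using f by (simp add: hcomp_id)
      finally have "f = ?g (module_hcomp (k+1) a n v)" by (rule sym)
      thus "f \<in> ?g ` ?V" using module_hcomp_in by blast
    qed
  qed
  moreover have "{v \<in> ?V. ?g v = 0} = ?M ` ?W"
  proof
    show "?M ` ?W \<subseteq> {v \<in> ?V. ?g v = 0}"
    proof safe
      fix w assume w: "w \<in> ?W"
      have "?M (module_hcomp k b n w) = module_hcomp (k+1) a n (?M w)"
        by (rule matrix_map_module_hcomp[OF M])
      hence "module_hcomp (k+1) a n (?M w) = ?M w" by (simp only: module_hcomp_id[OF w])
      with module_hcomp_in[of "k+1" a n "?M w"] show "?M w \<in> ?V" by (simp only:)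
      have "?M w \<in> {v \<in> free_module (k+1). ?g v = 0}"
        unfolding ker[symmetric] by (rule imageI, rule subsetD[OF graded_free_part_subset w])
      thus "?g (?M w) = 0" by blast
    qed
    show "{v \<in> ?V. ?g v = 0} \<subseteq> ?M ` ?W"
    proof
      fix v assume v: "v \<in> {v \<in> ?V. ?g v = 0}"
      hence "v \<in> {v \<in> free_module (k+1). ?g v = 0}" using graded_free_part_subset by blast
      hence "v \<in> ?M ` free_module k" unfolding ker .
      then obtain w where w: "v = ?M w" by blast
      have "?M (module_hcomp k b n w) = module_hcomp (k+1) a n v"
        unfolding w by (rule matrix_map_module_hcomp[OF M])
      also have "\<dots> = v" using v by (simp add: module_hcomp_id)
      finally have "v = ?M (module_hcomp k b n w)" by (rule sym)
      thus "v \<in> ?M ` ?W" using module_hcomp_in by blast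
    qed
  qed
  moreover have "fvec.dim (?M ` ?W) = fvec.dim ?W"
  proof -
    have "fvec.dim ?W = fvec.dim {w \<in> ?W. ?M w = 0} + fvec.dim (?M ` ?W)"
      by (rule vector_space_pair.dim_eq_kernel_plus_image[OF fvec_vector_space_pairs(2) subspace_graded_free_part G(2,1)])
        (unfold linear_from_fvec_iff, intro conjI allI matrix_map_add matrix_map_scale)
    moreover have "{w \<in> ?W. ?M w = 0} \<subseteq> {0}"
    proof
      fix w assume w: "w \<in> {w \<in> ?W. ?M w = 0}"
      hence "?M w = ?M 0" by (simp add: zero_fun_def)
      with w inj show "w \<in> {0}"
        using graded_free_part_subset[of k b n] by (auto simp: inj_on_def zero_fun_def)
    qed
    ultimately show ?thesis using fvec.dim_le_card[of "{w \<in> ?W. ?M w = 0}" "{}"] by simp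
  qed
  ultimately show ?thesis
    using dim_graded_free_part[of "k+1" a n, where 'a = 'a] dim_graded_free_part[of k b n, where 'a = 'a] by simp
qed

lemma hilbert_function_eq:
  fixes I :: "'a::field form_ring set"
  assumes "graded_free_resolution I k b a M g"
  shows "hilbert_function I n = dim_forms TYPE('a) n - 
    (\<Sum>i=1..k+1. dim_forms TYPE('a) (n - a i)) + (\<Sum>j=1..k. dim_forms TYPE('a) (n - b j))"
  using graded_free_resolution_dim[OF assms, of n] by (simp add: hilbert_function_def dim_forms_def forms_def)

text \<open>
  The first difference of the Hilbert function that a resolution with shifts \<open>a\<close> and \<open>b\<close> produces;
  \<open>max (n + 1) 0\<close> is the first difference of the dimension of the space of forms of degree \<open>n\<close>.
\<close>

definition betti_diff :: "nat \<Rightarrow> (nat \<Rightarrow> int) \<Rightarrow> (nat \<Rightarrow> int) \<Rightarrow> int \<Rightarrow> int" where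
  "betti_diff k b a n = max (n + 1) 0 - (\<Sum>i=1..k+1. max (n - a i + 1) 0) + (\<Sum>j=1..k. max (n - b j + 1) 0)"

lemma hilbert_diff_eq:
  fixes I :: "'a::field form_ring set"
  assumes "graded_free_resolution I k b a M g"
  shows "hilbert_diff I n = betti_diff k b a n"
proof -
  have *: "(\<Sum>i=1..m. dim_forms TYPE('a) (n - c i)) - (\<Sum>i=1..m. dim_forms TYPE('a) (n - 1 - c i))
     = (\<Sum>i=1..m. max (n - c i + 1) 0)" for m :: nat and c :: "nat \<Rightarrow> int"
    unfolding sum_subtractf[symmetric]
  proof (rule sum.cong)
    fix i
    have "n - 1 - c i = n - c i - 1" by simp
    thus "dim_forms TYPE('a) (n - c i) - dim_forms TYPE('a) (n - 1 - c i) = max (n - c i + 1) 0"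
      using dim_forms_diff[of "n - c i", where 'a = 'a] by (simp only:)
  qed simp
  show ?thesis
    unfolding hilbert_diff_def hilbert_function_eq[OF assms] betti_diff_def
    using *[where m = "k+1" and c = a] *[where m = k and c = b] dim_forms_diff[of n, where 'a = 'a] by linarith
qed

section \<open>Shifts of a minimal resolution\<close>

lemma minimal_imp_graded_free_resolution:
  "minimal_free_resolution I k b a M g \<Longrightarrow> graded_free_resolution I k b a M g"
  by (simp add: minimal_free_resolution_def graded_free_resolution_def)

definition unit_vector :: "nat \<Rightarrow> nat \<Rightarrow> 'r::comm_ring_1" where
  "unit_vector j = (\<lambda>i. if i = j then 1 else 0)"

lemma unit_vector_in: "j \<in> {1..n} \<Longrightarrow> unit_vector j \<in> free_module n"
  by (auto simp: unit_vector_def free_module_def)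

lemma matrix_map_unit_vector: "i \<in> {1..m} \<Longrightarrow> j \<in> {1..n} \<Longrightarrow> matrix_map m n M (unit_vector j) i = M i j"
  by (simp add: matrix_map_def unit_vector_def if_distrib[of "(*) _"] cong: if_cong)

lemma row_map_unit_vector: "j \<in> {1..n} \<Longrightarrow> row_map n g (unit_vector j) = g j"
  by (simp add: row_map_def unit_vector_def if_distrib[of "(*) _"] cong: if_cong)

locale minimal_resolution =
  fixes I :: "'a::field form_ring set" and k b a M g
  assumes res: "minimal_free_resolution I k b a M g"
    and b_mono: "mono_on {1..k} b" and a_mono: "mono_on {1..k+1} a"

begin

lemma homogeneous_g: "i \<in> {1..k+1} \<Longrightarrow> homogeneous (a i) (g i)"
  using res unfolding minimal_free_resolution_def by blast

lemma homogeneous_M: "i \<in> {1..k+1} \<Longrightarrow> j \<in> {1..k} \<Longrightarrow> homogeneous (b j - a i) (M i j)"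
  using res unfolding minimal_free_resolution_def by blast

lemma inj_M: "inj_on (matrix_map (k+1) k M) (free_module k)"
  using res unfolding minimal_free_resolution_def by blast

lemma exact: "matrix_map (k+1) k M ` free_module k = {v \<in> free_module (k+1). row_map (k+1) g v = 0}"
  using res unfolding minimal_free_resolution_def by blast

lemma image_g: "row_map (k+1) g ` free_module (k+1) = I"
  using res unfolding minimal_free_resolution_def by blast

lemma minimal: "w \<in> free_module k \<Longrightarrow> i \<in> {1..k+1} \<Longrightarrow> matrix_map (k+1) k M w i \<in> irrelevant_ideal"
  using res unfolding minimal_free_resolution_def by blast

lemma g_nonzero:
  assumes i: "i \<in> {1..k+1}" shows "g i \<noteq> 0"
proof
  assume "g i = 0"
  hence "unit_vector i \<in> {v \<in> free_module (k+1). row_map (k+1) g v = 0}"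
    using i by (simp only: mem_Collect_eq unit_vector_in row_map_unit_vector)
  then obtain w where w: "w \<in> free_module k" "unit_vector i = matrix_map (k+1) k M w"
    unfolding exact[symmetric] by blast
  have "(unit_vector i i :: 'a form_ring) \<in> irrelevant_ideal"
    unfolding w(2) by (rule minimal[OF w(1) i])
  thus False using irrelevant_ideal_lookup_0 by (fastforce simp: unit_vector_def)
qed

lemma a_nonneg: "i \<in> {1..k+1} \<Longrightarrow> a i \<ge> 0"
  using homogeneous_nonzero_degree[OF homogeneous_g g_nonzero] .

text \<open>
  The degree of the entry is not positive, and minimality puts it into the irrelevant ideal.
\<close>

lemma M_zero:
  assumes "i \<in> {1..k+1}" "j \<in> {1..k}" "b j \<le> a i" shows "M i j = 0"
proof (rule homogeneous_nonpos_irrelevant)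
  show "homogeneous (b j - a i) (M i j)" by (rule homogeneous_M[OF assms(1,2)])
  show "M i j \<in> irrelevant_ideal"
    using minimal[OF unit_vector_in[OF assms(2)] assms(1)] matrix_map_unit_vector[OF assms(1,2), of M] by simp
qed (use assms in simp)

lemma column_relation:
  assumes j: "j \<in> {1..k}" shows "(\<Sum>i=1..k+1. g i * M i j) = 0"
proof -
  have "matrix_map (k+1) k M (unit_vector j) \<in> {v \<in> free_module (k+1). row_map (k+1) g v = 0}"
    unfolding exact[symmetric] by (rule imageI[OF unit_vector_in[OF j]])
  hence "row_map (k+1) g (matrix_map (k+1) k M (unit_vector j)) = 0" by simp
  also have "row_map (k+1) g (matrix_map (k+1) k M (unit_vector j)) = (\<Sum>i=1..k+1. g i * M i j)"
    unfolding row_map_def by (rule sum.cong) (simp_all only: matrix_map_unit_vector[OF _ j])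
  finally show ?thesis .
qed

text \<open>
  If \<open>b p \<le> a (p + 1)\<close>, then the first \<open>p\<close> columns of \<open>M\<close> vanish below row \<open>p\<close>. The row vector
  \<open>g 1, \<dots>, g p\<close> is nonzero and is killed by the upper \<open>p \<times> p\<close> block, so the block has determinant zero
  and a kernel vector over the ring. Extended by zeros, it contradicts injectivity of \<open>M\<close>.
\<close>

lemma a_less_b:
  assumes p: "1 \<le> p" "p \<le> k" shows "a (p + 1) < b p"
proof (rule ccontr)
  assume neg: "\<not> a (p + 1) < b p"
  have zero: "M i j = 0" if "i \<in> {p+1..k+1}" "j \<in> {1..p}" for i j
  proof (rule M_zero)
    have "b j \<le> b p" using p that by (intro mono_onD[OF b_mono]) auto
    also have "\<dots> \<le> a (p + 1)" using neg by simp
    also have "\<dots> \<le> a i" using p that by (intro mono_onD[OF a_mono]) auto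
    finally show "b j \<le> a i" .
  qed (use p that in auto)
  \<comment> \<open>The matrix library counts rows and columns from zero.\<close>
  define B where "B = mat p p (\<lambda>(i, j). M (i + 1) (j + 1))"
  define G where "G = vec p (\<lambda>i. g (i + 1))"
  have B: "B \<in> carrier_mat p p" by (simp add: B_def)
  have "B\<^sup>T *\<^sub>v G = 0\<^sub>v p"
  proof (rule eq_vecI)
    fix j assume "j < dim_vec (0\<^sub>v p :: 'a form_ring vec)"
    hence j: "j < p" by simp
    have "0 = (\<Sum>i=1..k+1. g i * M i (j + 1))" by (rule column_relation[symmetric]) (use j p in auto)
    also have "\<dots> = (\<Sum>i=1..p. g i * M i (j + 1))"
      by (rule sum.mono_neutral_right) (use p j zero in \<open>auto simp: not_le\<close>)
    also have "\<dots> = (\<Sum>i<p. g (i + 1) * M (i + 1) (j + 1))"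
      by (rule sum.reindex_bij_witness[of _ "\<lambda>i. i + 1" "\<lambda>i. i - 1"]) auto
    also have "\<dots> = (B\<^sup>T *\<^sub>v G) $ j"
      using j by (simp add: B_def G_def scalar_prod_def lessThan_atLeast0 mult.commute)
    finally show "(B\<^sup>T *\<^sub>v G) $ j = 0\<^sub>v p $ j" using j by simp
  qed (simp add: B_def)
  moreover have "G \<noteq> 0\<^sub>v p"
  proof
    assume "G = 0\<^sub>v p"
    hence "G $ 0 = 0" using p by simp
    thus False using g_nonzero[of 1] p by (simp add: G_def)
  qed
  moreover have "G \<in> carrier_vec p" by (simp add: G_def)
  ultimately have "det B\<^sup>T = 0"
    using det_0_iff_vec_prod_zero[of "B\<^sup>T" p] B by auto
  hence "det B = 0" using det_transpose[OF B] by simp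
  then obtain v where v: "v \<in> carrier_vec p" "v \<noteq> 0\<^sub>v p" "B *\<^sub>v v = 0\<^sub>v p"
    using det_0_iff_vec_prod_zero[OF B] by auto
  define w where "w = (\<lambda>j. if j \<in> {1..p} then v $ (j - 1) else 0)"
  have "matrix_map (k+1) k M w = matrix_map (k+1) k M (\<lambda>_. 0)"
  proof
    fix i
    have "(\<Sum>j=1..k. M i j * w j) = 0" if i: "i \<in> {1..k+1}"
    proof (cases "i \<le> p")
      case True
      have i': "i - Suc 0 < p" "Suc (i - Suc 0) = i" using True i by auto
      have "(\<Sum>j=1..k. M i j * w j) = (\<Sum>j=1..p. M i j * v $ (j - 1))"
        by (rule sum.mono_neutral_cong_right) (use p in \<open>auto simp: w_def\<close>)
      also have "\<dots> = (\<Sum>j<p. M i (j + 1) * v $ j)"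
        by (rule sum.reindex_bij_witness[of _ "\<lambda>i. i + 1" "\<lambda>i. i - 1"]) auto
      also have "\<dots> = (B *\<^sub>v v) $ (i - 1)"
        using i' v(1) by (simp add: B_def scalar_prod_def lessThan_atLeast0)
      also have "\<dots> = 0" using i' v(3) by simp
      finally show ?thesis .
    next
      case False
      thus ?thesis using zero[of i] i by (intro sum.neutral) (auto simp: w_def)
    qed
    thus "matrix_map (k+1) k M w i = matrix_map (k+1) k M (\<lambda>_. 0) i"
      by (simp only: matrix_map_zero) (simp only: matrix_map_def split: if_split, blast)
  qed
  moreover have "w \<in> free_module k" using p by (auto simp: w_def free_module_def)
  ultimately have "w = (\<lambda>_. 0)" using inj_onD[OF inj_M] zero_in_free_module by blast
  have "v = 0\<^sub>v p"
  proof (rule eq_vecI)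
    fix j assume "j < dim_vec (0\<^sub>v p :: 'a form_ring vec)"
    thus "v $ j = 0\<^sub>v p $ j" using fun_cong[OF \<open>w = (\<lambda>_. 0)\<close>, of "j + 1"] by (simp add: w_def)
  qed (use v in simp)
  with v show False by simp
qed

text \<open>
  A form of degree \<open>d\<close> in \<open>I\<close> is a combination of generators in which only generators of degree at most
  \<open>d\<close> occur.
\<close>

lemma min_curve_degree_eq: "min_curve_degree I = nat (a 1)"
  unfolding min_curve_degree_def
proof (rule Least_equality)
  have "row_map (k+1) g (unit_vector 1) \<in> I"
    unfolding image_g[symmetric] by (rule imageI[OF unit_vector_in]) simp
  hence "g 1 \<in> I" by (subst (asm) row_map_unit_vector) simp_all
  thus "\<exists>f\<in>I. f \<noteq> 0 \<and> homogeneous (int (nat (a 1))) f"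
    using g_nonzero[of 1] homogeneous_g[of 1] a_nonneg[of 1] by (intro bexI[of _ "g 1"]) auto
next
  fix d assume "\<exists>f\<in>I. f \<noteq> 0 \<and> homogeneous (int d) f"
  then obtain f where f: "f \<in> I" "f \<noteq> 0" "homogeneous (int d) f" by blast
  from f(1) obtain v where v: "f = row_map (k+1) g v" unfolding image_g[symmetric] by blast
  have "hcomp (int d) f = row_map (k+1) g (module_hcomp (k+1) a (int d) v)"
    unfolding v by (rule row_map_module_hcomp[symmetric, OF homogeneous_g])
  hence "row_map (k+1) g (module_hcomp (k+1) a (int d) v) \<noteq> 0"
    using f by (simp add: hcomp_id)
  then obtain i where i: "i \<in> {1..k+1}" "g i * module_hcomp (k+1) a (int d) v i \<noteq> 0"
    unfolding row_map_def by (meson sum.neutral)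
  hence "hcomp (int d - a i) (v i) \<noteq> 0" by (auto simp: module_hcomp_def split: if_splits)
  hence "int d - a i \<ge> 0" by (rule homogeneous_nonzero_degree[OF homogeneous_hcomp])
  moreover have "a 1 \<le> a i" using i by (intro mono_onD[OF a_mono]) auto
  ultimately show "nat (a 1) \<le> d" by linarith
qed

end

section \<open>Existence of homogeneous primes\<close>

definition adjoin :: "'r::comm_ring_1 set \<Rightarrow> 'r \<Rightarrow> 'r set" where
  "adjoin J u = {p + u * r | p r. p \<in> J}"

lemma subset_adjoin: "J \<subseteq> adjoin J u"
proof
  fix p assume "p \<in> J"
  thus "p \<in> adjoin J u" unfolding adjoin_def by (intro CollectI exI[of _ p] exI[of _ 0]) simp
qed

lemma mem_adjoin: "0 \<in> J \<Longrightarrow> u \<in> adjoin J u"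
  unfolding adjoin_def by (intro CollectI exI[of _ 0] exI[of _ 1]) simp

lemma homogeneous_ideal_adjoin:
  assumes J: "homogeneous_ideal J" and u: "homogeneous e u"
  shows "homogeneous_ideal (adjoin J u)"
  unfolding homogeneous_ideal_iff
proof (intro conjI ballI allI)
  have sub: "idl.subspace J" and hc: "\<And>f d. f \<in> J \<Longrightarrow> hcomp d f \<in> J"
    using J by (auto simp: homogeneous_ideal_iff)
  show "idl.subspace (adjoin J u)"
  proof (rule idl.subspaceI)
    show "0 \<in> adjoin J u" using subset_adjoin idl.subspace_0[OF sub] by blast
  next
    fix f g assume "f \<in> adjoin J u" "g \<in> adjoin J u"
    then obtain p r q s where "f = p + u * r" "g = q + u * s" "p \<in> J" "q \<in> J" by (auto simp: adjoin_def)
    hence "f + g = (p + q) + u * (r + s)" "p + q \<in> J"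
      using idl.subspace_add[OF sub] by (auto simp: distrib_left)
    thus "f + g \<in> adjoin J u" unfolding adjoin_def by blast
  next
    fix c f assume "f \<in> adjoin J u"
    then obtain p r where "f = p + u * r" "p \<in> J" by (auto simp: adjoin_def)
    hence "c * f = c * p + u * (c * r)" "c * p \<in> J"
      using idl.subspace_scale[OF sub] by (auto simp: distrib_left mult.left_commute)
    thus "c * f \<in> adjoin J u" unfolding adjoin_def by blast
  qed
  fix f d assume "f \<in> adjoin J u"
  then obtain p r where "f = p + u * r" "p \<in> J" by (auto simp: adjoin_def)
  hence "hcomp d f = hcomp d p + u * hcomp (d - e) r" "hcomp d p \<in> J"
    using hc by (auto simp: hcomp_add hcomp_mult[OF u])
  thus "hcomp d f \<in> adjoin J u" unfolding adjoin_def by blast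
qed

text \<open>
  If neither \<open>f\<close> nor \<open>g\<close> lies in \<open>P\<close>, take the components of highest degree that are outside \<open>P\<close>. Their product is,
  modulo \<open>P\<close>, a component of \<open>f * g\<close>.
\<close>

lemma prime_ideal_if_prime_on_forms:
  assumes P: "homogeneous_ideal P" "1 \<notin> P"
    and prime: "\<And>d e u v. homogeneous d u \<Longrightarrow> homogeneous e v \<Longrightarrow> u * v \<in> P \<Longrightarrow> u \<in> P \<or> v \<in> P"
  shows "prime_ideal P"
proof -
  have sub: "idl.subspace P" and hc: "\<And>f d. f \<in> P \<Longrightarrow> hcomp d f \<in> P"
    using P(1) by (auto simp: homogeneous_ideal_iff)
  have top: "\<exists>i. hcomp i f \<notin> P \<and> (\<forall>d>i. hcomp d f \<in> P)" if "f \<notin> P" for f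
  proof -
    let ?D = "{d \<in> degrees f. hcomp d f \<notin> P}"
    have "?D \<noteq> {}"
    proof
      assume "?D = {}"
      hence "(\<Sum>d\<in>degrees f. hcomp d f) \<in> P" by (intro idl.subspace_sum[OF sub]) auto
      thus False using that by (simp add: sum_hcomp_degrees)
    qed
    have "Max ?D \<in> ?D" using Max_in[OF _ \<open>?D \<noteq> {}\<close>] by simp
    moreover have "hcomp d f \<in> P" if "d > Max ?D" for d
    proof (cases "d \<in> degrees f")
      case True
      show ?thesis
      proof (rule ccontr)
        assume "hcomp d f \<notin> P"
        hence "d \<le> Max ?D" using True by (intro Max_ge) auto
        with that show False by simp
      qed
    next
      case False
      hence "hcomp d f = 0" by (simp add: hcomp_eq_0_iff)
      thus ?thesis using idl.subspace_0[OF sub] by simp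
    qed
    ultimately show ?thesis by blast
  qed
  have "f \<in> P \<or> g \<in> P" if fg: "f * g \<in> P" for f g
  proof (rule ccontr)
    assume "\<not> (f \<in> P \<or> g \<in> P)"
    hence "f \<notin> P" "g \<notin> P" by blast+
    from top[OF this(1)] obtain i where i: "hcomp i f \<notin> P" "\<And>d. d > i \<Longrightarrow> hcomp d f \<in> P" by blast
    from top[OF \<open>g \<notin> P\<close>] obtain j where j: "hcomp j g \<notin> P" "\<And>d. d > j \<Longrightarrow> hcomp d g \<in> P" by blast
    have "i \<in> degrees f" 
    proof (rule ccontr)
      assume "i \<notin> degrees f"
      hence "hcomp i f = 0" by (simp add: hcomp_eq_0_iff)
      with i(1) idl.subspace_0[OF sub] show False by simp
    qed
    have "hcomp (i + j) (f * g) = hcomp (i + j) ((\<Sum>d\<in>degrees f. hcomp d f) * g)"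
      by (simp add: sum_hcomp_degrees)
    also have "\<dots> = (\<Sum>d\<in>degrees f. hcomp d f * hcomp (i + j - d) g)"
      by (simp add: sum_distrib_right hcomp_sum hcomp_mult[OF homogeneous_hcomp])
    also have "\<dots> = hcomp i f * hcomp j g + (\<Sum>d\<in>degrees f - {i}. hcomp d f * hcomp (i + j - d) g)"
      by (subst sum.remove[OF finite_degrees \<open>i \<in> degrees f\<close>]) simp
    finally have eq: "hcomp i f * hcomp j g =
      hcomp (i + j) (f * g) - (\<Sum>d\<in>degrees f - {i}. hcomp d f * hcomp (i + j - d) g)" by simp
    have "(\<Sum>d\<in>degrees f - {i}. hcomp d f * hcomp (i + j - d) g) \<in> P"
    proof (rule idl.subspace_sum[OF sub])
      fix d assume "d \<in> degrees f - {i}"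
      hence "d \<noteq> i" by simp
      then consider "d > i" | "i + j - d > j" by linarith
      thus "hcomp d f * hcomp (i + j - d) g \<in> P"
      proof cases
        case 1
        thus ?thesis by (subst mult.commute) (rule idl.subspace_scale[OF sub i(2)[OF 1]])
      next
        case 2
        thus ?thesis using idl.subspace_scale[OF sub j(2)[OF 2]] by blast
      qed
    qed
    hence "hcomp i f * hcomp j g \<in> P" unfolding eq using idl.subspace_diff[OF sub hc[OF fg]] by blast
    from prime[OF homogeneous_hcomp homogeneous_hcomp this] i(1) j(1) show False by blast
  qed
  with sub P(2) show ?thesis unfolding prime_ideal_def by blast
qed

text \<open>
  The homogeneous version of the existence of primes that avoid a multiplicative set. An ideal that is maximal
  among the homogeneous ideals disjoint from \<open>T\<close> is prime on forms: adjoining forms \<open>u\<close> and \<open>v\<close> outside it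
  yields elements \<open>p + u * r\<close> and \<open>q + v * s\<close> of \<open>T\<close>, whose product would lie in the ideal if \<open>u * v\<close> did.
\<close>

lemma exists_homogeneous_prime:
  assumes J: "homogeneous_ideal J" and T: "1 \<in> T" "\<And>s t. s \<in> T \<Longrightarrow> t \<in> T \<Longrightarrow> s * t \<in> T"
    and disj: "J \<inter> T = {}"
  obtains P where "prime_ideal P" "homogeneous_ideal P" "J \<subseteq> P" "P \<inter> T = {}"
proof -
  let ?A = "{P. homogeneous_ideal P \<and> J \<subseteq> P \<and> P \<inter> T = {}}"
  have "\<exists>P\<in>?A. \<forall>X\<in>?A. P \<subseteq> X \<longrightarrow> X = P"
  proof (rule subset_Zorn_nonempty)
    show "?A \<noteq> {}" using J disj by blast
    fix C assume "C \<noteq> {}" and C: "subset.chain ?A C"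
    then obtain P0 where P0: "P0 \<in> C" by blast
    have CA: "\<And>P. P \<in> C \<Longrightarrow> homogeneous_ideal P \<and> J \<subseteq> P \<and> P \<inter> T = {}"
      and lin: "\<And>P Q. P \<in> C \<Longrightarrow> Q \<in> C \<Longrightarrow> P \<subseteq> Q \<or> Q \<subseteq> P"
      using C unfolding subset_chain_def by blast+
    have sub: "\<And>P. P \<in> C \<Longrightarrow> idl.subspace P" and hc: "\<And>P f d. P \<in> C \<Longrightarrow> f \<in> P \<Longrightarrow> hcomp d f \<in> P"
      using CA unfolding homogeneous_ideal_iff by blast+
    have "idl.subspace (\<Union>C)"
    proof (rule idl.subspaceI)
      show "0 \<in> \<Union>C" using idl.subspace_0[OF sub[OF P0]] P0 by blast
    next
      fix x y assume "x \<in> \<Union>C" "y \<in> \<Union>C"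
      then obtain P where "P \<in> C" "x \<in> P" "y \<in> P" using lin by blast
      thus "x + y \<in> \<Union>C" using idl.subspace_add[OF sub] by blast
    next
      fix c x assume "x \<in> \<Union>C"
      thus "c * x \<in> \<Union>C" using idl.subspace_scale[OF sub] by blast
    qed
    hence "homogeneous_ideal (\<Union>C)" unfolding homogeneous_ideal_iff using hc by blast
    thus "\<Union>C \<in> ?A" using CA P0 by blast
  qed
  then obtain P where P: "homogeneous_ideal P" "J \<subseteq> P" "P \<inter> T = {}"
    and max: "\<And>X. homogeneous_ideal X \<Longrightarrow> P \<subseteq> X \<Longrightarrow> X \<inter> T = {} \<Longrightarrow> X = P"
    by (auto 4 4)
  have sub: "idl.subspace P" using P(1) by (simp add: homogeneous_ideal_iff)
  have meet: "\<exists>p r. p \<in> P \<and> p + u * r \<in> T" if "homogeneous d u" "u \<notin> P" for d u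
  proof -
    have "adjoin P u \<inter> T \<noteq> {}"
    proof
      assume "adjoin P u \<inter> T = {}"
      hence "adjoin P u = P" using max homogeneous_ideal_adjoin[OF P(1) that(1)] subset_adjoin by blast
      thus False using mem_adjoin[OF idl.subspace_0[OF sub], of u] that(2) by simp
    qed
    thus ?thesis unfolding adjoin_def by blast
  qed
  have "prime_ideal P"
  proof (rule prime_ideal_if_prime_on_forms[OF P(1)])
    show "1 \<notin> P" using P(3) T(1) by blast
    fix d e u v assume u: "homogeneous d u" and v: "homogeneous e v" and uv: "u * v \<in> P"
    show "u \<in> P \<or> v \<in> P"
    proof (rule ccontr)
      assume "\<not> (u \<in> P \<or> v \<in> P)"
      then obtain p r q s where p: "p \<in> P" "p + u * r \<in> T" and q: "q \<in> P" "q + v * s \<in> T"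
        using meet[OF u] meet[OF v] by blast
      have "(p + u * r) * (q + v * s) = (q + v * s) * p + (u * r) * q + (r * s) * (u * v)"
        by (simp add: algebra_simps)
      also have "\<dots> \<in> P"
        by (intro idl.subspace_add[OF sub] idl.subspace_scale[OF sub] p(1) q(1) uv)
      finally show False using T(2)[OF p(2) q(2)] P(3) by blast
    qed
  qed
  thus ?thesis using that P by blast
qed

section \<open>Coordinate primes and complete intersections\<close>

text \<open>
  The ideal generated by the variables with index in \<open>A\<close>, described by monomials. It is the kernel of the
  substitution of zero for these variables.
\<close>

definition coordinate_ideal :: "3 set \<Rightarrow> 'a::comm_ring_1 form_ring set" where
  "coordinate_ideal A = {f. \<forall>m\<in>Poly_Mapping.keys f. \<exists>i\<in>A. Poly_Mapping.lookup m i \<noteq> 0}"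

lemma coordinate_ideal_alt:
  "coordinate_ideal A = {f. restrict_keys (\<lambda>m. \<forall>i\<in>A. Poly_Mapping.lookup m i = 0) f = 0}"
  by (auto simp: coordinate_ideal_def restrict_keys_eq_0_iff)

lemma restrict_keys_coordinate_mult:
  "restrict_keys (\<lambda>m. \<forall>i\<in>A. Poly_Mapping.lookup m i = 0) (f * g) =
   restrict_keys (\<lambda>m. \<forall>i\<in>A. Poly_Mapping.lookup m i = 0) f *
   restrict_keys (\<lambda>m. \<forall>i\<in>A. Poly_Mapping.lookup m i = 0) (g :: 'a::comm_ring_1 form_ring)"
  by (rule restrict_keys_mult) (auto simp: lookup_add)

lemma prime_coordinate_ideal: "prime_ideal (coordinate_ideal A :: 'a::field form_ring set)"
  unfolding prime_ideal_def
proof (intro conjI allI impI)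
  show "idl.subspace (coordinate_ideal A :: 'a form_ring set)"
    unfolding coordinate_ideal_alt
    by (rule idl.subspaceI) (auto simp: restrict_keys_add restrict_keys_coordinate_mult)
  have "(1 :: 'a form_ring) \<notin> coordinate_ideal A" by (simp add: coordinate_ideal_def)
  thus "(coordinate_ideal A :: 'a form_ring set) \<noteq> UNIV" by blast
  fix f g :: "'a form_ring" assume "f * g \<in> coordinate_ideal A"
  thus "f \<in> coordinate_ideal A \<or> g \<in> coordinate_ideal A"
    by (simp add: coordinate_ideal_alt restrict_keys_coordinate_mult)
qed

lemma homogeneous_coordinate_ideal: "homogeneous_ideal (coordinate_ideal A :: 'a::field form_ring set)"
  using prime_coordinate_ideal[of A, where 'a = 'a]
  by (auto simp: homogeneous_ideal_iff prime_ideal_def coordinate_ideal_def hcomp_def)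

lemma var_in_coordinate_ideal_iff: "var i \<in> (coordinate_ideal A :: 'a::comm_ring_1 form_ring set) \<longleftrightarrow> i \<in> A"
  by (auto simp: coordinate_ideal_def var_def lookup_single when_def)

lemma coordinate_ideal_mono: "A \<subseteq> B \<Longrightarrow> coordinate_ideal A \<subseteq> coordinate_ideal B"
  unfolding coordinate_ideal_def by blast

lemma var_in_irrelevant_ideal: "var i \<in> irrelevant_ideal"
  unfolding irrelevant_ideal_def by (rule idl.span_base) simp

lemma single_split:
  assumes "Poly_Mapping.lookup m i \<ge> e"
  shows "\<exists>m'. m = Poly_Mapping.single i e + (m' :: 3 \<Rightarrow>\<^sub>0 nat)"
  by (rule exI[of _ "m - Poly_Mapping.single i e"], rule poly_mapping_eqI)
    (use assms in \<open>auto simp: lookup_add lookup_minus lookup_single when_def\<close>)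

lemma coordinate_ideal_singleton_dvd:
  assumes "f \<in> coordinate_ideal {i}" shows "\<exists>w. f = var i * (w :: 'a::comm_ring_1 form_ring)"
proof -
  have "\<exists>w. Poly_Mapping.single m c = var i * (w :: 'a form_ring)" if "m \<in> Poly_Mapping.keys f" for m and c :: 'a
  proof -
    have "Poly_Mapping.lookup m i \<ge> 1" using assms that by (auto simp: coordinate_ideal_def)
    from single_split[OF this] obtain m' where "m = Poly_Mapping.single i 1 + m'" by blast
    hence "Poly_Mapping.single m c = var i * Poly_Mapping.single m' c" by (simp add: var_def mult_single)
    thus ?thesis by blast
  qed
  then obtain w where w: "\<And>m c. m \<in> Poly_Mapping.keys f \<Longrightarrow> Poly_Mapping.single m c = var i * (w m c :: 'a form_ring)" by metis
  have "f = (\<Sum>m\<in>Poly_Mapping.keys f. Poly_Mapping.single m (Poly_Mapping.lookup f m))"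
    by (rule sum_single_lookup[symmetric]) auto
  also have "\<dots> = (\<Sum>m\<in>Poly_Mapping.keys f. var i * w m (Poly_Mapping.lookup f m))"
    by (rule sum.cong) (use w in auto)
  finally show ?thesis unfolding sum_distrib_left[symmetric] by blast
qed

text \<open>
  The variable is a prime element that does not divide \<open>f\<close>.
\<close>

lemma var_power_cancel:
  fixes f u v :: "'a::field form_ring"
  assumes f: "f \<notin> coordinate_ideal {i}" and eq: "f * u = var i ^ m * v"
  shows "\<exists>w. u = var i ^ m * w"
  using eq
proof (induction m arbitrary: u)
  case 0
  thus ?case by auto
next
  case (Suc m)
  have "var i ^ Suc m * v \<in> coordinate_ideal {i}"
    using prime_coordinate_ideal[of "{i}", where 'a = 'a] idl.subspace_scale[of "coordinate_ideal {i}" "var i" "var i ^ m * v"]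
    by (simp add: prime_ideal_def var_in_coordinate_ideal_iff mult_ac)
  hence "u \<in> coordinate_ideal {i}"
    using Suc.prems f prime_coordinate_ideal[of "{i}", where 'a = 'a] unfolding prime_ideal_def by metis
  then obtain u' where u': "u = var i * u'" using coordinate_ideal_singleton_dvd by blast
  have "var i * (f * u') = var i * (var i ^ m * v)" using Suc.prems u' by (simp add: mult_ac)
  hence "f * u' = var i ^ m * v" by simp
  then obtain w where "u' = var i ^ m * w" using Suc.IH by blast
  hence "u = var i ^ Suc m * w" using u' by (simp add: mult_ac)
  thus ?case by blast
qed

text \<open>
  The Koszul complex of the regular sequence \<open>f\<close>, \<open>var i ^ m\<close>.
\<close>

lemma graded_free_resolution_complete_intersection:
  fixes f :: "'a::field form_ring"
  assumes f: "f \<notin> coordinate_ideal {i}" and hom: "homogeneous d f"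
  shows "graded_free_resolution {f * u + var i ^ m * v | u v. True} 1 (\<lambda>_. d + int m)
    (\<lambda>l. if l = 1 then d else int m) (\<lambda>l _. if l = 1 then var i ^ m else - f) (\<lambda>l. if l = 1 then f else var i ^ m)"
proof -
  let ?x = "var i ^ m :: 'a form_ring"
  let ?M = "\<lambda>l (_::nat). if l = (1::nat) then ?x else - f"
  let ?g = "\<lambda>l. if l = (1::nat) then f else ?x"
  have f0: "f \<noteq> 0" using f by (auto simp: coordinate_ideal_def)
  have x0: "?x \<noteq> 0" by simp
  have two: "{1..1 + 1} = {1, 2::nat}" by auto
  have Mv: "matrix_map (1 + 1) 1 ?M v = (\<lambda>l. if l = 1 then ?x * v 1 else if l = 2 then - f * v 1 else 0)" for v
    unfolding matrix_map_def two by (auto simp: fun_eq_iff)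
  have gv: "row_map (1 + 1) ?g v = f * v 1 + ?x * v 2" for v
    unfolding row_map_def two by simp
  have mem1: "v \<in> free_module 1 \<longleftrightarrow> (\<forall>l. l \<noteq> 1 \<longrightarrow> v l = 0)" for v :: "nat \<Rightarrow> 'a form_ring"
    by (auto simp: free_module_def)
  have mem2: "v \<in> free_module (1 + 1) \<longleftrightarrow> (\<forall>l. l \<noteq> 1 \<and> l \<noteq> 2 \<longrightarrow> v l = 0)" for v :: "nat \<Rightarrow> 'a form_ring"
    unfolding free_module_def two by auto
  show ?thesis
    unfolding graded_free_resolution_def
  proof (intro conjI)
    show "\<forall>l\<in>{1..1 + 1}. homogeneous (if l = 1 then d else int m) (?g l)"
      using hom homogeneous_var_power by auto
    show "\<forall>l\<in>{1..1 + 1}. \<forall>j\<in>{1..1}. homogeneous (d + int m - (if l = 1 then d else int m)) (?M l j)"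
      using hom homogeneous_var_power by (auto simp: homogeneous_minus)
    show "inj_on (matrix_map (1 + 1) 1 ?M) (free_module 1)"
    proof (rule inj_onI)
      fix v w :: "nat \<Rightarrow> 'a form_ring"
      assume vw: "v \<in> free_module 1" "w \<in> free_module 1" and eq: "matrix_map (1 + 1) 1 ?M v = matrix_map (1 + 1) 1 ?M w"
      from fun_cong[OF eq, of 1] have "?x * v 1 = ?x * w 1" unfolding Mv by simp
      hence "v 1 = w 1" using x0 by simp
      thus "v = w" using vw unfolding mem1 by (metis ext)
    qed
    show "matrix_map (1 + 1) 1 ?M ` free_module 1 = {v \<in> free_module (1 + 1). row_map (1 + 1) ?g v = 0}"
    proof (intro equalityI subsetI)
      fix v assume "v \<in> matrix_map (1 + 1) 1 ?M ` free_module 1"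
      thus "v \<in> {v \<in> free_module (1 + 1). row_map (1 + 1) ?g v = 0}"
        by (auto simp only: mem_Collect_eq mem2 gv Mv) (simp_all add: mult_ac)
    next
      fix v assume v: "v \<in> {v \<in> free_module (1 + 1). row_map (1 + 1) ?g v = 0}"
      hence eq: "f * v 1 + ?x * v 2 = 0" by (simp only: mem_Collect_eq gv)
      hence "f * v 1 = ?x * (- v 2)" by (simp add: eq_neg_iff_add_eq_0)
      from var_power_cancel[OF f this] obtain u where u: "v 1 = ?x * u" by blast
      have "?x * (f * u + v 2) = 0" using eq u by (simp add: algebra_simps)
      hence u2: "v 2 = - f * u" using x0 by (simp add: add_eq_0_iff)
      have "v = matrix_map (1 + 1) 1 ?M (\<lambda>l. if l = 1 then u else 0)"
      proof
        fix l
        have "v l = 0" if "l \<noteq> 1" "l \<noteq> 2" using v that unfolding mem_Collect_eq mem2 by blast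
        thus "v l = matrix_map (1 + 1) 1 ?M (\<lambda>l. if l = 1 then u else 0) l"
          unfolding Mv using u u2 by simp
      qed
      moreover have "(\<lambda>l. if l = 1 then u else 0) \<in> free_module 1" unfolding mem1 by simp
      ultimately show "v \<in> matrix_map (1 + 1) 1 ?M ` free_module 1" by blast
    qed
    show "row_map (1 + 1) ?g ` free_module (1 + 1) = {f * u + ?x * v | u v. True}"
    proof (intro equalityI subsetI)
      fix h assume "h \<in> {f * u + ?x * v | u v. True}"
      then obtain u v where h: "h = f * u + ?x * v" by blast
      have "h = row_map (1 + 1) ?g (\<lambda>l. if l = 1 then u else if l = 2 then v else 0)"
        unfolding gv h by simp
      moreover have "(\<lambda>l. if l = 1 then u else if l = 2 then v else 0) \<in> free_module (1 + 1)"
        unfolding mem2 by simp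
      ultimately show "h \<in> row_map (1 + 1) ?g ` free_module (1 + 1)" by blast
    next
      fix h assume "h \<in> row_map (1 + 1) ?g ` free_module (1 + 1)"
      thus "h \<in> {f * u + ?x * v | u v. True}" unfolding image_iff gv by blast
    qed
  qed
qed

text \<open>
  The shifts \<open>d\<close> and \<open>m\<close> of the generators add up to the shift of the only relation, so
  the first difference of the Hilbert function vanishes from degree \<open>d + m\<close> on.
\<close>

lemma hilbert_function_complete_intersection_bounded:
  fixes f :: "'a::field form_ring"
  assumes f: "f \<notin> coordinate_ideal {i}" and hom: "homogeneous d f"
  shows "\<exists>C. \<forall>q::nat. hilbert_function {f * u + var i ^ m * v | u v. True} (int q) \<le> C"
proof -
  let ?I = "{f * u + var i ^ m * v | u v. True}"
  have f0: "f \<noteq> 0" using f by (auto simp: coordinate_ideal_def)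
  hence d: "d \<ge> 0" using homogeneous_nonzero_degree[OF hom] by blast
  define N where "N = nat d + m"
  have diff: "hilbert_diff ?I n = 0" if "n \<ge> int N" for n
    unfolding hilbert_diff_eq[OF graded_free_resolution_complete_intersection[OF f hom]] betti_diff_def
    using that d by (simp add: N_def numeral_2_eq_2)
  have const: "hilbert_function ?I (int (N + q)) = hilbert_function ?I (int N)" for q
  proof (induction q)
    case (Suc q)
    have "hilbert_diff ?I (int (N + Suc q)) = 0" by (rule diff) simp
    thus ?case using Suc unfolding hilbert_diff_def by simp
  qed simp
  define C where "C = Max ((\<lambda>q. hilbert_function ?I (int q)) ` {..N})"
  have "hilbert_function ?I (int q) \<le> C" for q
  proof (cases "q \<le> N")
    case True
    thus ?thesis unfolding C_def by (intro Max_ge) auto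
  next
    case False
    then obtain p where "q = N + p" by (metis le_Suc_ex nle_le)
    hence "hilbert_function ?I (int q) = hilbert_function ?I (int N)" using const by simp
    also have "\<dots> \<le> C" unfolding C_def by (intro Max_ge) auto
    finally show ?thesis .
  qed
  thus ?thesis by blast
qed

section \<open>The Hilbert function of a zero-dimensional subscheme is bounded\<close>

text \<open>
  The colon ideal of \<open>I\<close> by all powers of a variable: geometrically, the part of the scheme that does not lie on the
  coordinate line.
\<close>

definition var_saturation :: "3 \<Rightarrow> 'a::comm_ring_1 form_ring set \<Rightarrow> 'a form_ring set" where
  "var_saturation i I = {t. \<exists>n. var i ^ n * t \<in> I}"

lemma subset_var_saturation: "I \<subseteq> var_saturation i I"
proof
  fix f assume "f \<in> I"
  hence "var i ^ 0 * f \<in> I" by simp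
  thus "f \<in> var_saturation i I" unfolding var_saturation_def by blast
qed

lemma homogeneous_ideal_var_saturation:
  assumes I: "homogeneous_ideal I" shows "homogeneous_ideal (var_saturation i I)"
  unfolding homogeneous_ideal_iff
proof (intro conjI ballI allI)
  have sub: "idl.subspace I" and hc: "\<And>f d. f \<in> I \<Longrightarrow> hcomp d f \<in> I"
    using I by (auto simp: homogeneous_ideal_iff)
  show "idl.subspace (var_saturation i I)"
  proof (rule idl.subspaceI)
    show "0 \<in> var_saturation i I" using idl.subspace_0[OF sub] subset_var_saturation by blast
  next
    fix s t assume "s \<in> var_saturation i I" "t \<in> var_saturation i I"
    then obtain m n where m: "var i ^ m * s \<in> I" and n: "var i ^ n * t \<in> I" by (auto simp: var_saturation_def)
    have "var i ^ (m + n) * (s + t) = var i ^ n * (var i ^ m * s) + var i ^ m * (var i ^ n * t)"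
      by (simp add: power_add algebra_simps)
    also have "\<dots> \<in> I" by (intro idl.subspace_add[OF sub] idl.subspace_scale[OF sub] m n)
    finally show "s + t \<in> var_saturation i I" unfolding var_saturation_def by blast
  next
    fix c t assume "t \<in> var_saturation i I"
    then obtain n where n: "var i ^ n * t \<in> I" by (auto simp: var_saturation_def)
    have "var i ^ n * (c * t) = c * (var i ^ n * t)" by (rule mult.left_commute)
    also have "\<dots> \<in> I" by (rule idl.subspace_scale[OF sub n])
    finally show "c * t \<in> var_saturation i I" unfolding var_saturation_def by blast
  qed
  fix t d assume "t \<in> var_saturation i I"
  then obtain n where n: "var i ^ n * t \<in> I" by (auto simp: var_saturation_def)
  have "hcomp (d + int n) (var i ^ n * t) = var i ^ n * hcomp (d + int n - int n) t"
    by (rule hcomp_mult[OF homogeneous_var_power])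
  with hc[OF n, of "d + int n"] show "hcomp d t \<in> var_saturation i I"
    unfolding var_saturation_def by auto
qed

text \<open>
  Otherwise the whole line \<open>var 0 = 0\<close> is contained in the scheme, and the point where \<open>var 0\<close> and \<open>var 1\<close>
  vanish is a proper specialization of its generic point.
\<close>

lemma exists_form_not_divisible:
  fixes I :: "'a::field form_ring set"
  assumes Z: "zero_dim_subscheme I"
  shows "\<exists>f\<in>I. \<exists>d. homogeneous d f \<and> f \<notin> coordinate_ideal {0}"
proof (rule ccontr)
  assume *: "\<not> (\<exists>f\<in>I. \<exists>d. homogeneous d f \<and> f \<notin> coordinate_ideal {0})"
  have I: "homogeneous_ideal I" using Z by (simp add: zero_dim_subscheme_def)
  have "idl.span {f \<in> I. \<exists>d. homogeneous d f} \<subseteq> coordinate_ideal {0}"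
    by (rule idl.span_minimal) (use * prime_coordinate_ideal[of "{0}", where 'a = 'a] in \<open>auto simp: prime_ideal_def\<close>)
  hence "I \<subseteq> coordinate_ideal {0}" using I by (simp only: homogeneous_ideal_def)
  moreover have less: "(coordinate_ideal {0} :: 'a form_ring set) \<subset> coordinate_ideal {0, 1}"
  proof
    show "(coordinate_ideal {0} :: 'a form_ring set) \<subseteq> coordinate_ideal {0, 1}" by (rule coordinate_ideal_mono) simp
    have "(var 1 :: 'a form_ring) \<in> coordinate_ideal {0, 1}" "(var 1 :: 'a form_ring) \<notin> coordinate_ideal {0}"
      by (simp_all add: var_in_coordinate_ideal_iff)
    thus "(coordinate_ideal {0} :: 'a form_ring set) \<noteq> coordinate_ideal {0, 1}" by blast
  qed
  moreover have "(var 2 :: 'a form_ring) \<notin> coordinate_ideal {0, 1}"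
    by (simp add: var_in_coordinate_ideal_iff)
  hence "\<not> irrelevant_ideal \<subseteq> (coordinate_ideal {0, 1} :: 'a form_ring set)"
    using var_in_irrelevant_ideal by blast
  ultimately have "coordinate_ideal {0} \<in> proj_points I" "coordinate_ideal {0, 1} \<in> proj_points I"
    unfolding proj_points_def using prime_coordinate_ideal homogeneous_coordinate_ideal by blast+
  with less Z show False unfolding zero_dim_subscheme_def by blast
qed

text \<open>
  If the saturation is contained in \<open>P\<close>, then \<open>I\<close> is disjoint from the multiplicative set of all
  \<open>var i ^ n * t\<close> with \<open>t\<close> outside \<open>P\<close>. A homogeneous prime over \<open>I\<close> that avoids this set is contained in \<open>P\<close> and
  misses \<open>var i\<close>, so it is a proper generization of \<open>P\<close>.
\<close>

lemma var_saturation_not_subset_point: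
  fixes I :: "'a::field form_ring set"
  assumes Z: "zero_dim_subscheme I" and P: "P \<in> proj_points I" and x: "var i \<in> P"
  shows "\<not> var_saturation i I \<subseteq> P"
proof
  assume sat: "var_saturation i I \<subseteq> P"
  have I: "homogeneous_ideal I" using Z by (simp add: zero_dim_subscheme_def)
  have prime: "prime_ideal P" and irr: "\<not> irrelevant_ideal \<subseteq> P" using P by (auto simp: proj_points_def)
  have sub: "idl.subspace P" and one: "1 \<notin> P"
  proof -
    show "idl.subspace P" using prime by (simp add: prime_ideal_def)
    from idl.subspace_scale[OF this, of 1] show "1 \<notin> P" using prime by (auto simp: prime_ideal_def)
  qed
  let ?T = "{var i ^ n * t | n t. t \<notin> P}"
  have "1 \<in> ?T" using one by (intro CollectI exI[of _ 0] exI[of _ 1]) simp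
  moreover have "s * t \<in> ?T" if "s \<in> ?T" "t \<in> ?T" for s t
  proof -
    from that obtain m s' n t' where st: "s = var i ^ m * s'" "s' \<notin> P" "t = var i ^ n * t'" "t' \<notin> P" by blast
    have "s * t = var i ^ (m + n) * (s' * t')" using st by (simp add: power_add mult_ac)
    moreover have "s' * t' \<notin> P" using prime st unfolding prime_ideal_def by blast
    ultimately show ?thesis by blast
  qed
  moreover have "I \<inter> ?T = {}" using sat by (auto simp: var_saturation_def)
  ultimately obtain Q where Q: "prime_ideal Q" "homogeneous_ideal Q" "I \<subseteq> Q" "Q \<inter> ?T = {}"
    using exists_homogeneous_prime[OF I, of ?T] by blast
  have "Q \<subseteq> P"
  proof
    fix q assume "q \<in> Q"
    show "q \<in> P"
    proof (rule ccontr)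
      assume "q \<notin> P"
      hence "q \<in> ?T" by (intro CollectI exI[of _ 0] exI[of _ q]) simp
      with Q(4) \<open>q \<in> Q\<close> show False by blast
    qed
  qed
  moreover have "var i \<in> ?T" using one by (intro CollectI exI[of _ 1] exI[of _ 1]) simp
  hence "var i \<notin> Q" using Q(4) by blast
  ultimately have "Q \<subset> P" using x by blast
  moreover have "Q \<in> proj_points I" using Q \<open>Q \<subseteq> P\<close> irr unfolding proj_points_def by blast
  ultimately show False using Z P unfolding zero_dim_subscheme_def by blast
qed

text \<open>
  A homogeneous prime that avoids all powers of \<open>var l\<close> is relevant. If it contained the saturation and \<open>var i\<close>, it
  would be a point on the coordinate line that contradicts the previous lemma.
\<close>

lemma exists_var_power_in:
  fixes I :: "'a::field form_ring set"
  assumes Z: "zero_dim_subscheme I"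
  shows "\<exists>e. var l ^ e \<in> adjoin (var_saturation i I) (var i)"
proof (rule ccontr)
  assume *: "\<nexists>e. var l ^ e \<in> adjoin (var_saturation i I) (var i)"
  let ?K = "adjoin (var_saturation i I) (var i)"
  have I: "homogeneous_ideal I" using Z by (simp add: zero_dim_subscheme_def)
  have J: "homogeneous_ideal (var_saturation i I)" by (rule homogeneous_ideal_var_saturation[OF I])
  have K: "homogeneous_ideal ?K" by (rule homogeneous_ideal_adjoin[OF J homogeneous_var])
  have "s * t \<in> range ((^) (var l))" if "s \<in> range ((^) (var l))" "t \<in> range ((^) (var l))" for s t :: "'a form_ring"
    using that by (auto simp flip: power_add)
  moreover have "1 \<in> range ((^) (var l :: 'a form_ring))" by (rule range_eqI[of _ _ 0]) simp
  moreover have "?K \<inter> range ((^) (var l)) = {}" using * by auto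
  ultimately obtain P where P: "prime_ideal P" "homogeneous_ideal P" "?K \<subseteq> P" "P \<inter> range ((^) (var l)) = {}"
    using exists_homogeneous_prime[OF K, of "range ((^) (var l))"] by blast
  have "var l \<in> range ((^) (var l :: 'a form_ring))" by (rule range_eqI[of _ _ 1]) simp
  hence "\<not> irrelevant_ideal \<subseteq> P" using P(4) var_in_irrelevant_ideal by blast
  moreover have sat: "var_saturation i I \<subseteq> P" using subset_adjoin P(3) by blast
  hence "I \<subseteq> P" using subset_var_saturation by blast
  ultimately have "P \<in> proj_points I" using P unfolding proj_points_def by blast
  moreover have "0 \<in> var_saturation i I" using J idl.subspace_0 by (auto simp: homogeneous_ideal_iff)
  hence "var i \<in> P" using mem_adjoin P(3) by blast
  ultimately show False using var_saturation_not_subset_point[OF Z] sat by blast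
qed

text \<open>
  A monomial of degree at least the sum of the exponents is divisible by one of the pure powers.
\<close>

lemma exists_monomials_in:
  fixes I :: "'a::field form_ring set"
  assumes Z: "zero_dim_subscheme I"
  shows "\<exists>N. monomials (int N) \<subseteq> adjoin (var_saturation i I) (var i)"
proof -
  let ?K = "adjoin (var_saturation i I) (var i)"
  have I: "homogeneous_ideal I" using Z by (simp add: zero_dim_subscheme_def)
  have "homogeneous_ideal ?K"
    by (rule homogeneous_ideal_adjoin[OF homogeneous_ideal_var_saturation[OF I] homogeneous_var])
  hence sub: "idl.subspace ?K" by (simp add: homogeneous_ideal_iff)
  have "\<exists>e. \<forall>l. var l ^ e l \<in> ?K" by (intro choice allI exists_var_power_in[OF Z])
  then obtain e where e: "\<And>l. var l ^ e l \<in> ?K" by blast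
  have "Poly_Mapping.single m 1 \<in> ?K" if m: "mon_degree m = (\<Sum>l\<in>UNIV. e l)" for m
  proof -
    have "\<exists>l. Poly_Mapping.lookup m l \<ge> e l"
    proof (rule ccontr)
      assume "\<nexists>l. Poly_Mapping.lookup m l \<ge> e l"
      hence "mon_degree m < (\<Sum>l\<in>UNIV. e l)"
        unfolding mon_degree_def by (intro sum_strict_mono) (auto simp: not_le)
      with m show False by simp
    qed
    then obtain l m' where "m = Poly_Mapping.single l (e l) + m'" using single_split by blast
    hence "Poly_Mapping.single m 1 = Poly_Mapping.single m' 1 * (var l ^ e l :: 'a form_ring)"
      by (simp add: var_power mult_single add.commute)
    thus ?thesis using idl.subspace_scale[OF sub e] by simp
  qed
  thus ?thesis by (intro exI[of _ "\<Sum>l\<in>UNIV. e l"]) (auto simp: monomials_def simp del: of_nat_sum)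
qed

lemma monomial_split:
  "mon_degree m = p + q \<Longrightarrow> \<exists>m1 m2. m = m1 + m2 \<and> mon_degree m1 = p \<and> mon_degree m2 = q"
proof (induction q arbitrary: m)
  case 0
  thus ?case by (intro exI[of _ m] exI[of _ 0]) simp
next
  case (Suc q)
  have "m \<noteq> 0" using Suc.prems by auto
  then obtain l where "Poly_Mapping.lookup m l \<noteq> 0" by (auto simp: poly_mapping_eq_iff fun_eq_iff)
  then obtain m' where m': "m = Poly_Mapping.single l 1 + m'" using single_split[of 1 m l] by auto
  hence "mon_degree m' = p + q" using Suc.prems by (simp add: mon_degree_add)
  then obtain m1 m2 where "m' = m1 + m2" "mon_degree m1 = p" "mon_degree m2 = q" using Suc.IH by blast
  thus ?case using m'
    by (intro exI[of _ m1] exI[of _ "Poly_Mapping.single l 1 + m2"]) (simp add: mon_degree_add add_ac)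
qed

text \<open>
  The representatives \<open>t \<mu>\<close> of the monomials modulo \<open>x\<close> reduce the count in degree \<open>N + q\<close> to the
  codimension of the complete intersection \<open>(f, x ^ m)\<close> in degree \<open>q\<close>, once for each monomial \<open>\<mu>\<close> of degree
  \<open>N\<close>.
\<close>

lemma hilbert_function_bounded:
  fixes I :: "'a::field form_ring set"
  assumes Z: "zero_dim_subscheme I"
  shows "\<exists>N C. \<forall>q::nat. hilbert_function I (int (N + q)) \<le> C"
proof -
  let ?x = "var 0 :: 'a form_ring"
  have I: "homogeneous_ideal I" using Z by (simp add: zero_dim_subscheme_def)
  hence subI: "idl.subspace I" by (simp add: homogeneous_ideal_iff)
  have J: "homogeneous_ideal (var_saturation 0 I)" by (rule homogeneous_ideal_var_saturation[OF I])
  obtain N where N: "monomials (int N) \<subseteq> adjoin (var_saturation 0 I) ?x" using exists_monomials_in[OF Z] by blast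
  let ?S = "monomials (int N) :: 'a form_ring set"
  have "\<exists>t u n. \<mu> = t + ?x * u \<and> ?x ^ n * t \<in> I \<and> homogeneous (int N) t \<and> homogeneous (int N - 1) u"
    if "\<mu> \<in> ?S" for \<mu>
  proof -
    have "\<mu> \<in> adjoin (var_saturation 0 I) ?x" using N that by blast
    then obtain t u where tu: "\<mu> = t + ?x * u" "t \<in> var_saturation 0 I"
      unfolding adjoin_def by blast
    have "\<mu> \<in> forms (int N)" using that span_monomials kvec.span_base by blast
    hence "\<mu> = hcomp (int N) \<mu>" by (simp add: forms_def hcomp_id)
    also have "\<dots> = hcomp (int N) t + ?x * hcomp (int N - 1) u"
      unfolding tu(1) by (simp add: hcomp_add hcomp_mult[OF homogeneous_var])
    finally have "\<mu> = hcomp (int N) t + ?x * hcomp (int N - 1) u" .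
    moreover have "hcomp (int N) t \<in> var_saturation 0 I" using J tu(2) by (simp add: homogeneous_ideal_iff)
    ultimately show ?thesis unfolding var_saturation_def using homogeneous_hcomp by blast
  qed
  hence "\<forall>\<mu>\<in>?S. \<exists>t u n. \<mu> = t + ?x * u \<and> ?x ^ n * t \<in> I \<and> homogeneous (int N) t \<and> homogeneous (int N - 1) u"
    by blast
  from bchoice[OF this] obtain t where
    "\<forall>\<mu>\<in>?S. \<exists>u n. \<mu> = t \<mu> + ?x * u \<and> ?x ^ n * t \<mu> \<in> I \<and> homogeneous (int N) (t \<mu>) \<and> homogeneous (int N - 1) u" ..
  from bchoice[OF this] obtain u where
    "\<forall>\<mu>\<in>?S. \<exists>n. \<mu> = t \<mu> + ?x * u \<mu> \<and> ?x ^ n * t \<mu> \<in> I \<and> homogeneous (int N) (t \<mu>) \<and> homogeneous (int N - 1) (u \<mu>)" ..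
  from bchoice[OF this] obtain n where
    tun: "\<forall>\<mu>\<in>?S. \<mu> = t \<mu> + ?x * u \<mu> \<and> ?x ^ n \<mu> * t \<mu> \<in> I \<and> homogeneous (int N) (t \<mu>) \<and> homogeneous (int N - 1) (u \<mu>)" ..
  have tun: "\<And>\<mu>. \<mu> \<in> ?S \<Longrightarrow> \<mu> = t \<mu> + ?x * u \<mu>"
    "\<And>\<mu>. \<mu> \<in> ?S \<Longrightarrow> ?x ^ n \<mu> * t \<mu> \<in> I"
    "\<And>\<mu>. \<mu> \<in> ?S \<Longrightarrow> homogeneous (int N) (t \<mu>)" "\<And>\<mu>. \<mu> \<in> ?S \<Longrightarrow> homogeneous (int N - 1) (u \<mu>)"
    by (rule bspec[OF tun, THEN conjunct1], assumption,
        rule bspec[OF tun, THEN conjunct2, THEN conjunct1], assumption,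
        rule bspec[OF tun, THEN conjunct2, THEN conjunct2, THEN conjunct1], assumption,
        rule bspec[OF tun, THEN conjunct2, THEN conjunct2, THEN conjunct2], assumption)
  \<comment> \<open>The sum is a convenient common upper bound of the exponents.\<close>
  define m where "m = (\<Sum>\<mu>\<in>?S. n \<mu>)"
  have xm: "?x ^ m * t \<mu> \<in> I" if "\<mu> \<in> ?S" for \<mu>
  proof -
    have "n \<mu> \<le> m" unfolding m_def by (rule member_le_sum[OF that]) auto
    then obtain r where r: "m = r + n \<mu>" by (metis le_iff_add add.commute)
    have "?x ^ m * t \<mu> = ?x ^ r * (?x ^ n \<mu> * t \<mu>)" unfolding r power_add by (rule mult.assoc)
    thus ?thesis using idl.subspace_scale[OF subI tun(2)[OF that], of "?x ^ r"] by (simp only:)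
  qed
  \<comment> \<open>The step from \<open>q\<close> to \<open>q + 1\<close> multiplies by \<open>x\<close> and adds new multiples of the \<open>t \<mu>\<close>.\<close>
  define G where "G q = kvec.span ({t \<mu> * v | \<mu> v. \<mu> \<in> ?S \<and> v \<in> forms (int q)} \<union> {?x ^ q * r | r. r \<in> ?S})" for q
  have xG: "?x * f \<in> G (Suc q)" if "f \<in> G q" for f q
    using that unfolding G_def
  proof (induction rule: kvec.span_induct_alt)
    case base
    show ?case by (simp add: kvec.span_zero)
  next
    case (step c f g)
    have "?x * f \<in> G (Suc q)"
      using step(1)
    proof
      assume "f \<in> {t \<mu> * v | \<mu> v. \<mu> \<in> ?S \<and> v \<in> forms (int q)}"
      then obtain \<mu> v where f: "f = t \<mu> * v" "\<mu> \<in> ?S" "v \<in> forms (int q)" by blast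
      have "?x * f = t \<mu> * (?x * v)" using f by (simp add: mult.left_commute)
      moreover have "?x * v \<in> forms (int (Suc q))"
        using homogeneous_mult[OF homogeneous_var, of "int q" v 0] f(3) by (simp add: forms_def add.commute)
      ultimately show ?thesis unfolding G_def using f(2) by (intro kvec.span_base) blast
    next
      assume "f \<in> {?x ^ q * r | r. r \<in> ?S}"
      then obtain r where r: "f = ?x ^ q * r" "r \<in> ?S" by blast
      have "?x * f = ?x ^ Suc q * r" using r by (simp add: mult.assoc)
      thus ?thesis unfolding G_def using r(2) by (intro kvec.span_base) blast
    qed
    hence "const c * (?x * f) + ?x * g \<in> G (Suc q)"
      using step(2) unfolding G_def by (intro kvec.span_add kvec.span_scale)
    moreover have "?x * (const c * f + g) = const c * (?x * f) + ?x * g"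
      by (simp add: distrib_left mult.left_commute)
    ultimately show ?case unfolding G_def by simp
  qed
  have forms_G: "forms (int (N + q)) \<subseteq> G q" for q
  proof (induction q)
    case 0
    have "?S \<subseteq> G 0"
    proof
      fix r assume "r \<in> ?S"
      hence "?x ^ 0 * r \<in> G 0" unfolding G_def by (intro kvec.span_base) blast
      thus "r \<in> G 0" by simp
    qed
    hence "kvec.span ?S \<subseteq> G 0" unfolding G_def by (rule kvec.span_minimal) simp
    thus ?case by (simp add: span_monomials)
  next
    case (Suc q)
    have "monomials (int (N + Suc q)) \<subseteq> G (Suc q)"
    proof
      fix \<nu> :: "'a form_ring" assume "\<nu> \<in> monomials (int (N + Suc q))"
      then obtain l where l: "\<nu> = Poly_Mapping.single l 1" "mon_degree l = N + Suc q"
        by (auto simp: monomials_def)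
      \<comment> \<open>Replace a factor of degree \<open>N\<close> by its representative; the error is \<open>x\<close> times a form of degree \<open>N + q\<close>.\<close>
      obtain l1 l2 where l12: "l = l1 + l2" "mon_degree l1 = N" "mon_degree l2 = Suc q"
        using monomial_split[OF l(2)] by blast
      let ?\<mu> = "Poly_Mapping.single l1 1 :: 'a form_ring" and ?v = "Poly_Mapping.single l2 1 :: 'a form_ring"
      have mu: "?\<mu> \<in> ?S" using l12 by (auto simp: monomials_def)
      have v: "homogeneous (int (Suc q)) ?v" using homogeneous_single[of l2 "1::'a"] l12(3) by simp
      have "\<nu> = ?\<mu> * ?v" using l(1) l12(1) by (simp add: mult_single)
      also have "\<dots> = (t ?\<mu> + ?x * u ?\<mu>) * ?v" using tun(1)[OF mu] by (rule arg_cong)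
      also have "\<dots> = t ?\<mu> * ?v + ?x * (u ?\<mu> * ?v)" by (simp add: distrib_right mult.assoc)
      finally have "\<nu> = t ?\<mu> * ?v + ?x * (u ?\<mu> * ?v)" .
      moreover have "t ?\<mu> * ?v \<in> G (Suc q)"
        unfolding G_def using mu v by (intro kvec.span_base) (auto simp: forms_def)
      moreover have "u ?\<mu> * ?v \<in> forms (int (N + q))"
        using homogeneous_mult[OF tun(4)[OF mu] v] by (simp add: forms_def add.commute)
      hence "?x * (u ?\<mu> * ?v) \<in> G (Suc q)" using Suc.IH xG by blast
      ultimately show "\<nu> \<in> G (Suc q)" unfolding G_def by (simp add: kvec.span_add)
    qed
    hence "kvec.span (monomials (int (N + Suc q))) \<subseteq> G (Suc q)" 
      unfolding G_def by (rule kvec.span_minimal) simp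
    thus ?case by (simp only: span_monomials)
  qed
  obtain f d where f: "f \<in> I" "homogeneous d f" "f \<notin> coordinate_ideal {0}"
    using exists_form_not_divisible[OF Z] by blast
  let ?H = "{f * v + ?x ^ m * w | v w. True}"
  obtain C where C: "\<And>q::nat. hilbert_function ?H (int q) \<le> C"
    using hilbert_function_complete_intersection_bounded[OF f(3,2), of m] by blast
  have subH: "idl.subspace ?H"
  proof (rule idl.subspaceI)
    show "0 \<in> ?H" by (intro CollectI exI[of _ 0]) simp
  next
    fix p q assume "p \<in> ?H" "q \<in> ?H"
    then obtain v w v' w' where "p = f * v + ?x ^ m * w" "q = f * v' + ?x ^ m * w'" by blast
    hence "p + q = f * (v + v') + ?x ^ m * (w + w')" by (simp add: distrib_left)
    thus "p + q \<in> ?H" by blast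
  next
    fix c p assume "p \<in> ?H"
    then obtain v w where "p = f * v + ?x ^ m * w" by blast
    hence "c * p = f * (c * v) + ?x ^ m * (c * w)" by (simp add: distrib_left mult.left_commute)
    thus "c * p \<in> ?H" by blast
  qed
  have tH: "t \<mu> * h \<in> I" if mu: "\<mu> \<in> ?S" and h: "h \<in> ?H" for \<mu> h :: "'a form_ring"
  proof -
    obtain v w where "h = f * v + ?x ^ m * w" using h by blast
    hence "t \<mu> * h = (t \<mu> * v) * f + w * (?x ^ m * t \<mu>)" by (simp add: algebra_simps)
    also have "\<dots> \<in> I"
      by (intro idl.subspace_add[OF subI] idl.subspace_scale[OF subI] f(1) xm[OF mu])
    finally show ?thesis .
  qed
  have "hilbert_function I (int (N + q)) \<le> int (card ?S) * C + int (card ?S)" for q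
  proof -
    obtain A where A: "finite A" "A \<subseteq> forms (int q)" "int (card A) = hilbert_function ?H (int q)"
      "forms (int q) \<subseteq> {h + y | h y. h \<in> ?H \<and> y \<in> kvec.span A}"
      by (rule hilbert_function_complement[OF subH])
    let ?B1 = "\<Union>\<mu>\<in>?S. (*) (t \<mu>) ` A" and ?B2 = "(*) (?x ^ q) ` ?S"
    let ?B = "?B1 \<union> ?B2"
    have cardB: "card ?B \<le> card ?S * card A + card ?S"
    proof -
      have "card ?B1 \<le> (\<Sum>\<mu>\<in>?S. card ((*) (t \<mu>) ` A))" by (rule card_UN_le) simp
      also have "\<dots> \<le> (\<Sum>\<mu>\<in>?S. card A)" by (intro sum_mono card_image_le A(1))
      finally have "card ?B1 \<le> card ?S * card A" by simp
      moreover have "card ?B2 \<le> card ?S" by (rule card_image_le) simp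
      ultimately show ?thesis using card_Un_le[of ?B1 ?B2] by linarith
    qed
    let ?R = "{i + y | i y. i \<in> I \<and> y \<in> kvec.span ?B}"
    have subR: "kvec.subspace ?R"
    proof (rule kvec.subspace_sums)
      show "kvec.subspace I"
        by (rule kvec.subspaceI) (use subI in \<open>auto intro: idl.subspace_0 idl.subspace_add idl.subspace_scale\<close>)
    qed simp
    have "G q \<subseteq> ?R"
      unfolding G_def
    proof (rule kvec.span_minimal[OF _ subR], rule Un_least)
      show "{t \<mu> * v | \<mu> v. \<mu> \<in> ?S \<and> v \<in> forms (int q)} \<subseteq> ?R"
      proof safe
        fix \<mu> v :: "'a form_ring" assume mu: "\<mu> \<in> ?S" and "v \<in> forms (int q)"
        then obtain h y where hy: "v = h + y" "h \<in> ?H" "y \<in> kvec.span A" using A(4) by blast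
        have "t \<mu> * y \<in> kvec.span ?B"
          using hy(3)
        proof (induction rule: kvec.span_induct_alt)
          case (step c y z)
          have "t \<mu> * y \<in> kvec.span ?B" using mu step(1) by (intro kvec.span_base) blast
          hence "const c * (t \<mu> * y) + t \<mu> * z \<in> kvec.span ?B"
            using step(2) by (intro kvec.span_add kvec.span_scale)
          thus ?case by (simp add: distrib_left mult.left_commute)
        qed (simp add: kvec.span_zero)
        moreover have "t \<mu> * h \<in> I" by (rule tH[OF mu hy(2)])
        moreover have "t \<mu> * v = t \<mu> * h + t \<mu> * y" using hy(1) by (simp add: distrib_left)
        ultimately show "\<exists>i y. t \<mu> * v = i + y \<and> i \<in> I \<and> y \<in> kvec.span ?B" by blast
      qed
      show "{?x ^ q * r | r. r \<in> ?S} \<subseteq> ?R"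
      proof safe
        fix r assume "r \<in> ?S"
        hence "?x ^ q * r \<in> kvec.span ?B" by (intro kvec.span_base) blast
        thus "\<exists>i y. ?x ^ q * r = i + y \<and> i \<in> I \<and> y \<in> kvec.span ?B"
          using idl.subspace_0[OF subI] by (intro exI[of _ 0] exI[of _ "?x ^ q * r"]) simp
      qed
    qed
    hence "forms (int (N + q)) \<subseteq> ?R" using forms_G by blast
    moreover have "?B \<subseteq> forms (int (N + q))"
    proof -
      have "t \<mu> * y \<in> forms (int (N + q))" if "\<mu> \<in> ?S" "y \<in> A" for \<mu> y
        using homogeneous_mult[OF tun(3)[OF that(1)], of "int q" y] A(2) that(2) by (auto simp: forms_def)
      moreover have "?x ^ q * r \<in> forms (int (N + q))" if "r \<in> ?S" for r
      proof -
        have "r \<in> forms (int N)" using that span_monomials kvec.span_base by blast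
        thus ?thesis
          using homogeneous_mult[OF homogeneous_var_power, of "int N" r q 0] by (simp add: forms_def add.commute)
      qed
      ultimately show ?thesis by blast
    qed
    moreover have "finite ?B" using A(1) by simp
    ultimately have "hilbert_function I (int (N + q)) \<le> int (card ?B)"
      by (intro hilbert_function_le_card)
    also have "\<dots> \<le> int (card ?S * card A + card ?S)" using cardB by linarith
    also have "\<dots> = int (card ?S) * hilbert_function ?H (int q) + int (card ?S)" using A(3) by simp
    also have "\<dots> \<le> int (card ?S) * C + int (card ?S)" using C[of q] by (intro add_right_mono mult_left_mono) auto
    finally show ?thesis .
  qed
  thus ?thesis by blast
qed

text \<open>
  The first difference of the Hilbert function is eventually the constant \<open>c\<close>, the difference of the two sums.
  A bounded nonnegative function with this property has \<open>c = 0\<close>.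
\<close>

lemma sum_shifts_eq:
  fixes I :: "'a::field form_ring set"
  assumes Z: "zero_dim_subscheme I" and res: "graded_free_resolution I k b a M g"
  shows "(\<Sum>i=1..k+1. a i) = (\<Sum>j=1..k. b j)"
proof -
  obtain N C where NC: "\<And>q::nat. hilbert_function I (int (N + q)) \<le> C"
    using hilbert_function_bounded[OF Z] by blast
  define c where "c = (\<Sum>i=1..k+1. a i) - (\<Sum>j=1..k. b j)"
  define Ta Tb where "Ta = nat (Max (a ` {1..k+1}))" and "Tb = nat (Max (insert 0 (b ` {1..k})))"
  define T where "T = N + Ta + Tb"
  have diff: "hilbert_diff I n = c" if n: "n \<ge> int T" for n
  proof -
    have a: "a i \<le> n" if "i \<in> {1..k+1}" for i
    proof -
      have "a i \<le> Max (a ` {1..k+1})" using that by (intro Max_ge) auto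
      also have "\<dots> \<le> int Ta" unfolding Ta_def by linarith
      finally show ?thesis using n by (simp add: T_def)
    qed
    have b: "b j \<le> n" if "j \<in> {1..k}" for j
    proof -
      have "b j \<le> Max (insert 0 (b ` {1..k}))" using that by (intro Max_ge) auto
      also have "\<dots> \<le> int Tb" unfolding Tb_def by linarith
      finally show ?thesis using n by (simp add: T_def)
    qed
    have "(\<Sum>i=1..k+1. max (n - a i + 1) 0) = (\<Sum>i=1..k+1. n + 1 - a i)"
      using a by (intro sum.cong) auto
    moreover have "(\<Sum>j=1..k. max (n - b j + 1) 0) = (\<Sum>j=1..k. n + 1 - b j)"
      using b by (intro sum.cong) auto
    ultimately show ?thesis using n unfolding hilbert_diff_eq[OF res] betti_diff_def c_def
      by (simp add: sum_subtractf algebra_simps)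
  qed
  have H: "hilbert_function I (int (T + q)) = hilbert_function I (int T) + int q * c" for q
  proof (induction q)
    case (Suc q)
    have "hilbert_function I (int (T + Suc q)) - hilbert_function I (int (T + q)) = c"
      using diff[of "int (T + Suc q)"] by (simp add: hilbert_diff_def)
    thus ?case using Suc by (simp add: algebra_simps)
  qed simp
  have "c = 0"
  proof (rule ccontr)
    assume "c \<noteq> 0"
    then consider "c \<ge> 1" | "c \<le> -1" by linarith
    thus False
    proof cases
      case 1
      let ?q = "nat (C + 1)"
      have "C < int ?q * 1" by simp
      also have "\<dots> \<le> int ?q * c" using 1 by (intro mult_left_mono) auto
      also have "\<dots> \<le> hilbert_function I (int (T + ?q))" using H[of ?q] hilbert_function_nonneg[of I "int T"] by simp
      also have "T + ?q = N + (Ta + Tb + ?q)" by (simp add: T_def)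
      also have "hilbert_function I (int \<dots>) \<le> C" by (rule NC)
      finally show False by simp
    next
      case 2
      let ?q = "nat (hilbert_function I (int T) + 1)"
      have "int ?q * c \<le> int ?q * (-1)" using 2 by (intro mult_left_mono) auto
      hence "hilbert_function I (int (T + ?q)) < 0" using H[of ?q] hilbert_function_nonneg[of I "int T"] by simp
      with hilbert_function_nonneg[of I "int (T + ?q)"] show False by simp
    qed
  qed
  thus ?thesis by (simp add: c_def)
qed

section \<open>Conjugate partitions and gaps\<close>

lemma le_card_sublevel_iff:
  fixes c :: "nat \<Rightarrow> int"
  assumes c: "mono_on {1..m} c" and p: "1 \<le> p" "p \<le> m"
  shows "p \<le> card {i \<in> {1..m}. c i \<le> n} \<longleftrightarrow> c p \<le> n"
proof
  assume "c p \<le> n"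
  hence "{1..p} \<subseteq> {i \<in> {1..m}. c i \<le> n}"
    using p by (auto intro: order_trans[OF mono_onD[OF c, of _ p]])
  from card_mono[OF _ this] show "p \<le> card {i \<in> {1..m}. c i \<le> n}" by simp
next
  assume *: "p \<le> card {i \<in> {1..m}. c i \<le> n}"
  show "c p \<le> n"
  proof (rule ccontr)
    assume "\<not> c p \<le> n"
    hence "{i \<in> {1..m}. c i \<le> n} \<subseteq> {1..<p}"
      using p mono_onD[OF c, of p] by (auto simp: not_le) (meson dual_order.trans not_le)
    from card_mono[OF _ this] * p show False by simp
  qed
qed

lemma card_sublevel_decreasing_iff:
  assumes "sorted_wrt (\<ge>) (ns :: int list)" "l < length ns"
  shows "l + 1 \<le> card {l'. l' < length ns \<and> ns ! l' \<ge> x} \<longleftrightarrow> ns ! l \<ge> x"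
proof
  assume "ns ! l \<ge> x"
  hence "{..l} \<subseteq> {l'. l' < length ns \<and> ns ! l' \<ge> x}"
    using assms by (auto simp: sorted_wrt_iff_nth_less) (metis le_neq_implies_less order_trans)+
  from card_mono[OF _ this] show "l + 1 \<le> card {l'. l' < length ns \<and> ns ! l' \<ge> x}" by simp
next
  assume *: "l + 1 \<le> card {l'. l' < length ns \<and> ns ! l' \<ge> x}"
  show "ns ! l \<ge> x"
  proof (rule ccontr)
    assume neg: "\<not> ns ! l \<ge> x"
    have "{l'. l' < length ns \<and> ns ! l' \<ge> x} \<subseteq> {..<l}"
    proof safe
      fix l' assume l': "l' < length ns" "ns ! l' \<ge> x"
      show "l' < l" 
      proof (rule ccontr)
        assume "\<not> l' < l"
        hence "ns ! l \<ge> ns ! l'" using assms l' by (cases "l = l'") (auto simp: sorted_wrt_iff_nth_less)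
        with neg l' show False by simp
      qed
    qed
    from card_mono[OF _ this] * show False by simp
  qed
qed

text \<open>
  The part of the numerical character that depends only on \<open>s\<close> and on the first difference \<open>D\<close> in degrees
  from \<open>s\<close> on: \<open>ns\<close> and \<open>D\<close> are conjugate partitions, apart from the \<open>s\<close> that is added to all parts.
\<close>

definition is_conjugate :: "nat \<Rightarrow> (int \<Rightarrow> int) \<Rightarrow> int list \<Rightarrow> bool" where
  "is_conjugate s D ns \<longleftrightarrow>
     length ns = s \<and> sorted_wrt (\<ge>) ns \<and> (\<forall>x\<in>set ns. x \<ge> int s) \<and>
     (\<forall>i\<ge>int s. D i = int (card {l. l < s \<and> ns ! l \<ge> i + 1}))"

text \<open>
  Transposition of the Young diagram. Everything else about conjugates is derived from this equivalence.
\<close>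

lemma is_conjugate_nth_iff:
  assumes "is_conjugate s D ns" "l < s" "i \<ge> int s"
  shows "ns ! l \<ge> i + 1 \<longleftrightarrow> D i \<ge> int l + 1"
proof -
  have "D i = int (card {l'. l' < length ns \<and> ns ! l' \<ge> i + 1})"
    using assms by (auto simp: is_conjugate_def)
  thus ?thesis
    using card_sublevel_decreasing_iff[of ns l "i + 1"] assms by (auto simp: is_conjugate_def)
qed

lemma is_conjugate_unique:
  assumes "is_conjugate s D ns" "is_conjugate s D ms" shows "ns = ms"
proof (rule nth_equalityI)
  show len: "length ns = length ms" using assms by (simp add: is_conjugate_def)
  fix l assume "l < length ns"
  hence l: "l < s" "ns ! l \<ge> int s" "ms ! l \<ge> int s"
    using assms len by (auto simp: is_conjugate_def)
  have "ns ! l \<ge> i + 1 \<longleftrightarrow> ms ! l \<ge> i + 1" if "i \<ge> int s" for i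
    using is_conjugate_nth_iff[OF assms(1) l(1) that] is_conjugate_nth_iff[OF assms(2) l(1) that] by simp
  from this[of "ns ! l - 1"] this[of "ms ! l - 1"] l show "ns ! l = ms ! l" by linarith
qed

lemma is_conjugate_exists:
  assumes anti: "\<And>i j. int s \<le> i \<Longrightarrow> i \<le> j \<Longrightarrow> D j \<le> D i"
    and le: "D (int s) \<le> int s" and zero: "\<And>i. i \<ge> N \<Longrightarrow> D i = 0"
  shows "\<exists>ns. is_conjugate s D ns"
proof -
  define L where "L l = {i. int s \<le> i \<and> D i \<ge> int l + 1}" for l
  define ns where "ns = map (\<lambda>l. int s + int (card (L l))) [0..<s]"
  have finL: "finite (L l)" for l
  proof (rule finite_subset)
    show "L l \<subseteq> {int s..N}"
    proof
      fix i assume i: "i \<in> L l"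
      thus "i \<in> {int s..N}" using zero[of i] by (cases "i \<ge> N") (auto simp: L_def)
    qed
  qed simp
  have nth: "int s + int (card (L l)) \<ge> i + 1 \<longleftrightarrow> D i \<ge> int l + 1" if "i \<ge> int s" for i l
  proof
    assume *: "D i \<ge> int l + 1"
    hence "{int s..i} \<subseteq> L l" using anti by (force simp: L_def)
    from card_mono[OF finL this] that show "int s + int (card (L l)) \<ge> i + 1" by simp
  next
    assume *: "int s + int (card (L l)) \<ge> i + 1"
    show "D i \<ge> int l + 1"
    proof (rule ccontr)
      assume neg: "\<not> D i \<ge> int l + 1"
      have "L l \<subseteq> {int s..<i}"
      proof
        fix j assume j: "j \<in> L l"
        show "j \<in> {int s..<i}"
        proof (rule ccontr)
          assume "j \<notin> {int s..<i}"
          hence "D j \<le> D i" using j that by (intro anti) (auto simp: L_def)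
          with neg j show False by (simp add: L_def)
        qed
      qed
      from card_mono[OF _ this] * that show False by simp
    qed
  qed
  have "sorted_wrt (\<ge>) ns"
    unfolding sorted_wrt_iff_nth_less
  proof (intro allI impI)
    fix l l' assume l: "l < l'" "l' < length ns"
    hence "L l' \<subseteq> L l" by (auto simp: L_def)
    from card_mono[OF finL this] l show "ns ! l \<ge> ns ! l'" by (simp add: ns_def)
  qed
  moreover have "D i = int (card {l. l < s \<and> ns ! l \<ge> i + 1})" if "i \<ge> int s" for i
  proof -
    have "D i \<le> int s" using anti[of "int s" i] le that by simp
    moreover have "D i \<ge> 0" using anti[of i "max i N"] zero[of "max i N"] that by simp
    moreover have "{l. l < s \<and> ns ! l \<ge> i + 1} = {..<nat (min (int s) (D i))}"
      using nth[OF that] by (auto simp: ns_def)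
    ultimately show ?thesis by simp
  qed
  ultimately have "is_conjugate s D ns" by (auto simp: is_conjugate_def ns_def)
  thus ?thesis ..
qed

text \<open>
  For a gap \<open>ns ! l > ns ! (l + 1) + 1\<close>, the two values of \<open>D\<close> at \<open>ns ! (l + 1)\<close> and at its successor
  are both \<open>l + 1\<close>. The bound \<open>D i < int s\<close> says that there is an entry after the gap.
\<close>

lemma connected_is_conjugate_iff:
  assumes ns: "is_conjugate s D ns"
  shows "\<not> connected_character ns \<longleftrightarrow> (\<exists>i>int s. D i = D (i - 1) \<and> 0 < D i \<and> D i < int s)"
proof
  assume "\<not> connected_character ns"
  then obtain l where l: "l + 1 < length ns" "ns ! l > ns ! (l + 1) + 1"
    by (auto simp: connected_character_def not_le)
  have s: "length ns = s" "ns ! (l + 1) \<ge> int s" using ns l(1) by (auto simp: is_conjugate_def)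
  \<comment> \<open>The first degree in which the entry at \<open>l + 1\<close> no longer counts.\<close>
  define i where "i = ns ! (l + 1) + 1"
  have i: "i > int s" using s by (simp add: i_def)
  have eq: "D j = int (card {l. l < s \<and> ns ! l \<ge> j + 1})" if "j \<ge> int s" for j
    using ns that by (simp add: is_conjugate_def)
  have "{l. l < s \<and> ns ! l \<ge> i + 1} \<subseteq> {l. l < s \<and> ns ! l \<ge> (i-1) + 1}" by auto
  from card_mono[OF _ this] have anti: "D i \<le> D (i - 1)" using eq[of i] eq[of "i-1"] i by simp
  have "D i \<ge> int l + 1" using is_conjugate_nth_iff[OF ns, of l i] l s i by (simp add: i_def)
  moreover have "\<not> D (i - 1) \<ge> int (l + 1) + 1"
    using is_conjugate_nth_iff[OF ns, of "l+1" "i-1"] l s i by (simp add: i_def)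
  ultimately show "\<exists>i>int s. D i = D (i - 1) \<and> 0 < D i \<and> D i < int s"
    using i anti l s by (intro exI[of _ i]) auto
next
  assume "\<exists>i>int s. D i = D (i - 1) \<and> 0 < D i \<and> D i < int s"
  then obtain i where i: "i > int s" "D i = D (i - 1)" "0 < D i" "D i < int s" by blast
  define l where "l = nat (D i) - 1"
  have l: "D i = int l + 1" "l + 1 < s" using i by (auto simp: l_def)
  have "ns ! l \<ge> i + 1" using is_conjugate_nth_iff[OF ns, of l i] l i by simp
  moreover have "\<not> ns ! (l + 1) \<ge> (i - 1) + 1"
    using is_conjugate_nth_iff[OF ns, of "l+1" "i-1"] l i by simp
  moreover have "length ns = s" using ns by (simp add: is_conjugate_def)
  ultimately show "\<not> connected_character ns"
    using l unfolding connected_character_def by (auto intro!: exI[of _ l])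
qed

section \<open>The second difference of the Hilbert function\<close>

lemma betti_diff_step:
  assumes "n \<ge> 0"
  shows "betti_diff k b a n - betti_diff k b a (n - 1) =
    1 - int (card {i \<in> {1..k+1}. a i \<le> n}) + int (card {j \<in> {1..k}. b j \<le> n})"
proof -
  have *: "(\<Sum>i=1..m. max (n - c i + 1) 0) - (\<Sum>i=1..m. max (n - 1 - c i + 1) 0)
     = int (card {i \<in> {1..m}. c i \<le> n})" for m and c :: "nat \<Rightarrow> int"
  proof -
    have "(\<Sum>i=1..m. max (n - c i + 1) 0) - (\<Sum>i=1..m. max (n - 1 - c i + 1) 0)
      = (\<Sum>i=1..m. if c i \<le> n then 1 else 0)"
      unfolding sum_subtractf[symmetric] by (rule sum.cong) auto
    also have "\<dots> = int (card {i \<in> {1..m}. c i \<le> n})" by (simp add: sum.If_cases Int_def)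
    finally show ?thesis .
  qed
  show ?thesis using *[where m = "k+1" and c = a] *[where m = k and c = b] assms by (simp add: betti_diff_def)
qed

text \<open>
  What is left of the geometry: the shifts of a minimal resolution of a zero-dimensional subscheme.
\<close>

locale betti_numbers =
  fixes k :: nat and a b :: "nat \<Rightarrow> int"
  assumes a_mono: "mono_on {1..k+1} a" and b_mono: "mono_on {1..k} b"
    and a_nonneg: "a 1 \<ge> 0"
    and a_less_b: "\<And>p. 1 \<le> p \<Longrightarrow> p \<le> k \<Longrightarrow> a (p + 1) < b p"
    and sum_eq: "(\<Sum>i=1..k+1. a i) = (\<Sum>j=1..k. b j)"

begin

abbreviation "D \<equiv> betti_diff k b a"

definition "A n = card {i \<in> {1..k+1}. a i \<le> n}"

definition "B n = card {j \<in> {1..k}. b j \<le> n}"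

lemma a_le: "1 \<le> p \<Longrightarrow> p \<le> q \<Longrightarrow> q \<le> k + 1 \<Longrightarrow> a p \<le> a q"
  using mono_onD[OF a_mono, of p q] by simp

lemma b_le: "1 \<le> p \<Longrightarrow> p \<le> q \<Longrightarrow> q \<le> k \<Longrightarrow> b p \<le> b q"
  using mono_onD[OF b_mono, of p q] by simp

lemma le_A: "1 \<le> p \<Longrightarrow> p \<le> k + 1 \<Longrightarrow> p \<le> A n \<longleftrightarrow> a p \<le> n"
  unfolding A_def by (rule le_card_sublevel_iff[OF a_mono])

lemma le_B: "1 \<le> p \<Longrightarrow> p \<le> k \<Longrightarrow> p \<le> B n \<longleftrightarrow> b p \<le> n"
  unfolding B_def by (rule le_card_sublevel_iff[OF b_mono])

lemma B_le: "B n \<le> k"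
  unfolding B_def by (rule order_trans[OF card_mono[of "{1..k}"]]) auto

lemma A_mono: "m \<le> n \<Longrightarrow> A m \<le> A n"
  unfolding A_def by (rule card_mono) auto

lemma B_mono: "m \<le> n \<Longrightarrow> B m \<le> B n"
  unfolding B_def by (rule card_mono) auto

text \<open>
  With \<open>p = B n\<close>, the inequality \<open>a (p + 1) < b p \<le> n\<close> exhibits one more \<open>a i\<close> up to \<open>n\<close>.
\<close>

lemma B_less_A:
  assumes "n \<ge> a 1" shows "B n < A n"
proof (cases "B n = 0")
  case True
  thus ?thesis using le_A[of 1 n] assms by simp
next
  case False
  hence "b (B n) \<le> n" using le_B[of "B n" n] B_le[of n] by simp
  hence "a (B n + 1) \<le> n" using a_less_b[of "B n"] False B_le[of n] by simp
  thus ?thesis using le_A[of "B n + 1" n] B_le[of n] by simp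
qed

lemma D_step: "n \<ge> 0 \<Longrightarrow> D n - D (n - 1) = 1 - int (A n) + int (B n)"
  unfolding A_def B_def by (rule betti_diff_step)

lemma D_step_le:
  assumes "n \<ge> a 1" shows "D n \<le> D (n - 1)"
  using D_step[of n] B_less_A[OF assms] a_nonneg assms by simp

lemma D_antimono:
  assumes "a 1 \<le> i + 1" "i \<le> j" shows "D j \<le> D i"
  using assms(2)
proof (induction j rule: int_ge_induct)
  case (step j)
  thus ?case using D_step_le[of "j + 1"] assms(1) by simp
qed simp

lemma b_ge: "1 \<le> j \<Longrightarrow> j \<le> k \<Longrightarrow> a 1 < b j"
  using a_le[of 1 "j + 1"] a_less_b[of j] by simp

lemma D_initial:
  assumes "-1 \<le> n" "n < a 1" shows "D n = n + 1"
proof -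
  have "(\<Sum>i=1..k+1. max (n - a i + 1) 0) = 0"
  proof (rule sum.neutral, rule ballI)
    fix i assume "i \<in> {1..k+1}"
    thus "max (n - a i + 1) 0 = 0" using a_le[of 1 i] assms by simp
  qed
  moreover have "(\<Sum>i=1..k. max (n - b i + 1) 0) = 0"
  proof (rule sum.neutral, rule ballI)
    fix i assume "i \<in> {1..k}"
    thus "max (n - b i + 1) 0 = 0" using b_ge[of i] assms by simp
  qed
  ultimately show ?thesis using assms by (simp add: betti_diff_def)
qed

text \<open>
  For \<open>k = 0\<close> there is no \<open>b k\<close>.
\<close>

definition "top_shift = max (a (k + 1)) (if k = 0 then a 1 else b k)"

lemma D_final:
  assumes "n \<ge> top_shift" shows "D n = 0"
proof -
  have ai: "a i \<le> n" if "i \<in> {1..k+1}" for i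
    using a_le[of i "k+1"] that assms by (auto simp: top_shift_def)
  have bi: "b i \<le> n" if "i \<in> {1..k}" for i
    using b_le[of i k] that assms by (auto simp: top_shift_def split: if_splits)
  have "n \<ge> 0" using ai[of 1] a_nonneg by simp
  have "(\<Sum>i=1..k+1. max (n - a i + 1) 0) = (\<Sum>i=1..k+1. n + 1 - a i)"
    using ai by (intro sum.cong) auto
  moreover have "(\<Sum>i=1..k. max (n - b i + 1) 0) = (\<Sum>i=1..k. n + 1 - b i)"
    using bi by (intro sum.cong) auto
  ultimately show ?thesis using sum_eq \<open>n \<ge> 0\<close>
    unfolding betti_diff_def by (simp add: sum_subtractf algebra_simps)
qed

lemma D_nonneg: "n \<ge> a 1 \<Longrightarrow> D n \<ge> 0"
  using D_antimono[of n "max n top_shift"] D_final[of "max n top_shift"] by simp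

lemma conjugate_exists: "\<exists>ns. is_conjugate (nat (a 1)) D ns"
proof (rule is_conjugate_exists)
  show "D j \<le> D i" if "int (nat (a 1)) \<le> i" "i \<le> j" for i j
    using that a_nonneg by (intro D_antimono) auto
  show "D (int (nat (a 1))) \<le> int (nat (a 1))"
    using D_step_le[of "a 1"] D_initial[of "a 1 - 1"] a_nonneg by simp
  show "\<And>i. i \<ge> top_shift \<Longrightarrow> D i = 0" by (rule D_final)
qed

text \<open>
  The witnesses correspond by \<open>p = B i\<close> and \<open>i = b p\<close>. The bounds \<open>0 < D i\<close> and \<open>D i < a 1\<close>
  exclude the plateaus with \<open>p = k\<close>, where all shifts are used up and \<open>D\<close> is zero, and with
  \<open>p = 0\<close>, where \<open>D\<close> still has its initial value \<open>a 1\<close>.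
\<close>

lemma plateau_iff:
  "(\<exists>i>a 1. D i = D (i - 1) \<and> 0 < D i \<and> D i < a 1) \<longleftrightarrow>
   (\<exists>p. 1 \<le> p \<and> p \<le> k - 1 \<and> b p < a (p + 2))"
proof
  assume "\<exists>i>a 1. D i = D (i - 1) \<and> 0 < D i \<and> D i < a 1"
  then obtain i where i: "i > a 1" "D i = D (i - 1)" "0 < D i" "D i < a 1" by blast
  have AB: "A i = B i + 1" using D_step[of i] i a_nonneg by simp
  have "B i \<noteq> 0"
  proof
    assume "B i = 0"
    hence "A i = 1" using AB by simp
    have "D j = a 1" if "a 1 - 1 \<le> j" "j \<le> i" for j
      using that
    proof (induction j rule: int_ge_induct)
      case base
      show ?case using D_initial[of "a 1 - 1"] a_nonneg by simp
    next
      case (step j)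
      have "A (j + 1) \<le> 1" "B (j + 1) = 0"
        using A_mono[of "j + 1" i] B_mono[of "j + 1" i] step \<open>A i = 1\<close> \<open>B i = 0\<close> by simp_all
      thus ?case using D_step[of "j + 1"] B_less_A[of "j + 1"] step a_nonneg by simp
    qed
    from this[of i] i show False by simp
  qed
  moreover have "B i \<noteq> k"
  proof
    assume "B i = k"
    have "i \<ge> top_shift"
      using le_A[of "k+1" i] le_B[of k i] AB \<open>B i = k\<close> by (auto simp: top_shift_def)
    with D_final i show False by simp
  qed
  ultimately have p: "1 \<le> B i" "B i \<le> k - 1" using B_le[of i] by auto
  have "b (B i) \<le> i" using le_B[of "B i" i] p by simp
  moreover have "i < a (B i + 2)"
  proof -
    have "B i + 2 \<le> k + 1" using p by arith
    thus ?thesis using le_A[of "B i + 2" i] AB by simp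
  qed
  ultimately show "\<exists>p. 1 \<le> p \<and> p \<le> k - 1 \<and> b p < a (p + 2)"
    using p by (intro exI[of _ "B i"]) auto
next
  assume "\<exists>p. 1 \<le> p \<and> p \<le> k - 1 \<and> b p < a (p + 2)"
  then obtain p where p: "1 \<le> p" "p \<le> k - 1" "b p < a (p + 2)" by blast
  have "p + 1 \<le> k" using p by arith
  note p = p this
  define i where "i = b p"
  have "a 1 < i" using b_ge[of p] p by (simp add: i_def)
  have "B i \<ge> p" using le_B[of p i] p by (simp add: i_def)
  moreover have "\<not> A i \<ge> p + 2" using le_A[of "p + 2" i] p by (simp add: i_def)
  ultimately have eq: "D i = D (i - 1)" using B_less_A[of i] \<open>a 1 < i\<close> D_step[of i] a_nonneg by simp
  have pos: "0 < D i"
  proof -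
    let ?j = "a (k + 1)"
    have "i < ?j" using p a_le[of "p + 2" "k + 1"] by (simp add: i_def)
    have "A ?j \<ge> k + 1" using le_A[of "k+1" ?j] by simp
    moreover have "\<not> B ?j \<ge> k" using le_B[of k ?j] a_less_b[of k] p by simp
    ultimately have "D ?j < D (?j - 1)" using D_step[of ?j] \<open>a 1 < i\<close> \<open>i < ?j\<close> a_nonneg by simp
    moreover have "D (?j - 1) \<le> D i" using \<open>a 1 < i\<close> \<open>i < ?j\<close> by (intro D_antimono) auto
    ultimately show ?thesis using D_nonneg[of ?j] \<open>a 1 < i\<close> \<open>i < ?j\<close> by simp
  qed
  have lt: "D i < a 1"
  proof -
    let ?j = "a 2"
    have "?j < i" using a_less_b[of 1] b_le[of 1 p] p by (simp add: i_def numeral_2_eq_2)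
    have j1: "a 1 \<le> ?j" using a_le[of 1 2] p by simp
    have "A ?j \<ge> 2" using le_A[of 2 ?j] p by simp
    moreover have "\<not> B ?j \<ge> 1" using le_B[of 1 ?j] a_less_b[of 1] p by (simp add: numeral_2_eq_2)
    ultimately have "D ?j < D (?j - 1)" using D_step[of ?j] j1 a_nonneg by simp
    also have "\<dots> \<le> D (a 1 - 1)" using j1 by (intro D_antimono) auto
    also have "\<dots> = a 1" using D_initial[of "a 1 - 1"] a_nonneg by simp
    finally have "D ?j < a 1" .
    moreover have "D i \<le> D ?j" using \<open>?j < i\<close> j1 by (intro D_antimono) auto
    ultimately show ?thesis by simp
  qed
  from eq pos lt \<open>a 1 < i\<close> show "\<exists>i>a 1. D i = D (i - 1) \<and> 0 < D i \<and> D i < a 1" by blast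
qed

end

section \<open>Connectedness of the numerical character\<close>

theorem theorem7:
  fixes I :: "'a::{alg_closed_field, field_char_0} form_ring set"
    and k :: nat and a b :: "nat \<Rightarrow> int"
    and M :: "nat \<Rightarrow> nat \<Rightarrow> 'a form_ring" and g :: "nat \<Rightarrow> 'a form_ring"
  assumes "zero_dim_subscheme I"
    and "minimal_free_resolution I k b a M g"
    and "mono_on {1..k} b" and "mono_on {1..k+1} a"
  shows "\<not> connected_character (numerical_character I) \<longleftrightarrow>
         (\<exists>p. 1 \<le> p \<and> p \<le> k - 1 \<and> b p < a (p + 2))"
proof -
  interpret R: minimal_resolution I k b a M g by unfold_locales (rule assms)+
  have res: "graded_free_resolution I k b a M g"
    by (rule minimal_imp_graded_free_resolution[OF assms(2)])
  interpret N: betti_numbers k a b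
  proof
    show "a 1 \<ge> 0" by (rule R.a_nonneg) simp
  qed (use assms R.a_less_b sum_shifts_eq[OF assms(1) res] in auto)
  have D: "hilbert_diff I = betti_diff k b a" by (rule ext) (rule hilbert_diff_eq[OF res])
  have s: "int (min_curve_degree I) = a 1" using R.min_curve_degree_eq N.a_nonneg by simp
  \<comment> \<open>Below degree \<open>s\<close> the resolution gives the values that the character prescribes; conjugacy is what remains.\<close>
  have char: "is_numerical_character I ns \<longleftrightarrow> is_conjugate (min_curve_degree I) (betti_diff k b a) ns" for ns
    using N.D_initial s by (auto simp: is_numerical_character_def is_conjugate_def Let_def D)
  obtain ns where ns: "is_conjugate (min_curve_degree I) (betti_diff k b a) ns"
    using N.conjugate_exists R.min_curve_degree_eq by auto
  have "numerical_character I = ns"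
    unfolding numerical_character_def char using ns is_conjugate_unique by blast
  thus ?thesis using connected_is_conjugate_iff[OF ns] N.plateau_iff s by simp
qed

end
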